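(* The functor $U\colon\mathbf{CellCx}\to\mathbf{Top}^{\mathbf 2}$ has a right adjoint.
   Context: $\mathbf{Top}^{\mathbf 2}$ is the arrow category of topological spaces. $\mathcal{J}$ is the set of inclusions $S^{n-1}\hookrightarrow D^n$, $n\ge 0$ (with $S^{-1}=\emptyset$, $S^0$ the endpoints of $D^1$); $\kappa\in\mathcal{J}$ is written $\partial\kappa\to\overline\kappa$. A stratum $(X,S)$ is a space $X$ (its boundary), a set $S$ of cells, and for each $s\in S$ an element $\kappa_s\in\mathcal{J}$ and a continuous map $b_s\colon\partial\kappa_s\to X$. Its body $\overline{(X,S)}$ is the pushout of $\coprod_s\overline{\kappa_s}\leftarrow\coprod_s\partial\kappa_s\xrightarrow{\langle b_s\rangle}X$, and $U(X,S)$ is the map $X\to\overline{(X,S)}$. A morphism $(f,p)\colon(X,S)\to(Y,T)$ of strata is a continuous $f\colon X\to Y$ and a function $p\colon S\to T$ with $\kappa_s=\kappa_{p(s)}$ and $f\circ b_s=b_{p(s)}$ for all $s\in S$; it induces $\overline{(f,p)}$ on bodies, and $U(f,p)=(f,\overline{(f,p)})$. A relative cell complex is a sequence of strata $(X_n,S_n)_{n\in\mathbb{N}}$ ($n\ge0$) which is connected ($X_{n+1}=\overline{(X_n,S_n)}$ for all $n$) and proper (for no $n$ and $s\in S_n$ does $b_s$ factor through $X_m\to X_n$ for some $m<n$). Its boundary is $X_0$, its body is the colimit of $X_0\to X_1\to\cdots$, and $U$ sends it to the transfinite composite from $X_0$ to the body. A morphism of relative cell complexes is a sequence of strata morphisms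 $(f_n,p_n)\colon(X_n,S_n)\to(Y_n,T_n)$ with $f_{n+1}=\overline{(f_n,p_n)}$ for all $n$; $U$ sends it to the square formed by $f_0$ and the induced map on bodies. $\mathbf{CellCx}$ is the resulting category. *)

theory Defs
  imports "HOL-Analysis.Analysis"
begin

section \<open>Categories, functors and adjunctions\<close>

text \<open>Hom-sets need not be disjoint, so composition is indexed by the three objects involved:
  \<open>Comp C X Y Z g f\<close> is the composite of \<open>f\<close> from \<open>X\<close> to \<open>Y\<close> and \<open>g\<close> from \<open>Y\<close> to \<open>Z\<close>.\<close>

record ('o, 'm) category =
  Obj :: "'o set"
  Hom :: "'o \<Rightarrow> 'o \<Rightarrow> 'm set"
  Id :: "'o \<Rightarrow> 'm"
  Comp :: "'o \<Rightarrow> 'o \<Rightarrow> 'o \<Rightarrow> 'm \<Rightarrow> 'm \<Rightarrow> 'm"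

definition is_category :: "('o, 'm) category \<Rightarrow> bool" where
  "is_category C \<longleftrightarrow>
     (\<forall>X\<in>Obj C. Id C X \<in> Hom C X X) \<and>
     (\<forall>X\<in>Obj C. \<forall>Y\<in>Obj C. \<forall>Z\<in>Obj C. \<forall>f\<in>Hom C X Y. \<forall>g\<in>Hom C Y Z.
        Comp C X Y Z g f \<in> Hom C X Z) \<and>
     (\<forall>X\<in>Obj C. \<forall>Y\<in>Obj C. \<forall>f\<in>Hom C X Y.
        Comp C X X Y f (Id C X) = f \<and> Comp C X Y Y (Id C Y) f = f) \<and>
     (\<forall>W\<in>Obj C. \<forall>X\<in>Obj C. \<forall>Y\<in>Obj C. \<forall>Z\<in>Obj C.
        \<forall>f\<in>Hom C W X. \<forall>g\<in>Hom C X Y. \<forall>h\<in>Hom C Y Z.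
        Comp C W Y Z h (Comp C W X Y g f) = Comp C W X Z (Comp C X Y Z h g) f)"

record ('o, 'm, 'p, 'n) functor_data =
  ObjMap :: "'o \<Rightarrow> 'p"
  ArrMap :: "'o \<Rightarrow> 'o \<Rightarrow> 'm \<Rightarrow> 'n"

definition is_functor ::
  "('o, 'm) category \<Rightarrow> ('p, 'n) category \<Rightarrow> ('o, 'm, 'p, 'n) functor_data \<Rightarrow> bool" where
  "is_functor C D F \<longleftrightarrow>
     is_category C \<and> is_category D \<and>
     (\<forall>X\<in>Obj C. ObjMap F X \<in> Obj D) \<and>
     (\<forall>X\<in>Obj C. \<forall>Y\<in>Obj C. \<forall>f\<in>Hom C X Y.
        ArrMap F X Y f \<in> Hom D (ObjMap F X) (ObjMap F Y)) \<and>
     (\<forall>X\<in>Obj C. ArrMap F X X (Id C X) = Id D (ObjMap F X)) \<and>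
     (\<forall>X\<in>Obj C. \<forall>Y\<in>Obj C. \<forall>Z\<in>Obj C. \<forall>f\<in>Hom C X Y. \<forall>g\<in>Hom C Y Z.
        ArrMap F X Z (Comp C X Y Z g f) =
        Comp D (ObjMap F X) (ObjMap F Y) (ObjMap F Z) (ArrMap F Y Z g) (ArrMap F X Y f))"

definition adjunction ::
  "('o, 'm) category \<Rightarrow> ('p, 'n) category \<Rightarrow> ('o, 'm, 'p, 'n) functor_data \<Rightarrow>
   ('p, 'n, 'o, 'm) functor_data \<Rightarrow> ('o \<Rightarrow> 'p \<Rightarrow> 'n \<Rightarrow> 'm) \<Rightarrow> bool" where
  "adjunction C D F G \<phi> \<longleftrightarrow>
     is_functor C D F \<and> is_functor D C G \<and>
     (\<forall>X\<in>Obj C. \<forall>Y\<in>Obj D.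
        bij_betw (\<phi> X Y) (Hom D (ObjMap F X) Y) (Hom C X (ObjMap G Y))) \<and>
     (\<forall>X'\<in>Obj C. \<forall>X\<in>Obj C. \<forall>Y\<in>Obj D. \<forall>Y'\<in>Obj D.
        \<forall>h\<in>Hom C X' X. \<forall>g\<in>Hom D (ObjMap F X) Y. \<forall>k\<in>Hom D Y Y'.
        \<phi> X' Y' (Comp D (ObjMap F X') Y Y' k
                   (Comp D (ObjMap F X') (ObjMap F X) Y g (ArrMap F X' X h))) =
        Comp C X' (ObjMap G Y) (ObjMap G Y') (ArrMap G Y Y' k)
          (Comp C X' X (ObjMap G Y) (\<phi> X Y g) h))"

definition has_right_adjoint ::
  "('o, 'm) category \<Rightarrow> ('p, 'n) category \<Rightarrow> ('o, 'm, 'p, 'n) functor_data \<Rightarrow> bool" where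
  "has_right_adjoint C D F \<longleftrightarrow> (\<exists>G \<phi>. adjunction C D F G \<phi>)"

definition arrow_category :: "('o, 'm) category \<Rightarrow> ('o \<times> 'o \<times> 'm, 'm \<times> 'm) category" where
  "arrow_category C =
     \<lparr> Obj = {(A, B, f). A \<in> Obj C \<and> B \<in> Obj C \<and> f \<in> Hom C A B},
       Hom = (\<lambda>(A, B, f) (A', B', f').
                {(u, v). u \<in> Hom C A A' \<and> v \<in> Hom C B B' \<and>
                         Comp C A A' B' f' u = Comp C A B B' v f}),
       Id = (\<lambda>(A, B, f). (Id C A, Id C B)),
       Comp = (\<lambda>(A, B, f) (A', B', f') (A'', B'', f'') (u', v') (u, v).
                 (Comp C A A' A'' u' u, Comp C B B' B'' v' v)) \<rparr>"


section \<open>Small topological spaces\<close>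

text \<open>As there is no type of all topological spaces, sets and spaces are taken relative to a
  universe: a family \<open>\<S>\<close> of subsets of a type \<open>'u\<close>, the small ones.  The closure conditions hold
  for the sets in any uncountable Grothendieck universe (with \<open>'u\<close> of inaccessible cardinality and
  \<open>\<S>\<close> its subsets of smaller cardinality), but they are weak enough to be satisfied within HOL, and
  by universes containing a copy of any given type; see \<open>universe_exists\<close> below.\<close>

definition universe :: "'u set set \<Rightarrow> bool" where
  "universe \<S> \<longleftrightarrow>
     (\<exists>A\<in>\<S>. \<exists>x\<in>A. \<exists>y\<in>A. x \<noteq> y) \<and>
     (\<forall>A\<in>\<S>. \<forall>B. B \<lesssim> A \<longrightarrow> B \<in> \<S>) \<and>
     (\<forall>A\<in>\<S>. \<exists>B\<in>\<S>. ((UNIV :: real set) \<rightarrow>\<^sub>E A) \<lesssim> B) \<and>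
     (\<forall>A :: nat \<Rightarrow> 'u set. (\<forall>n. A n \<in> \<S>) \<longrightarrow> (\<Union>n. A n) \<in> \<S>)"

lemma universe_exists: "universe (UNIV :: (real \<times> 'a) set set set)"
proof -
  have "(UNIV :: real set) \<times> (UNIV :: real set) \<lesssim> (UNIV :: real set)"
    by (intro eqpoll_imp_lepoll eqpoll_iff_card_of_ordIso[THEN iffD2]
          card_of_Times_same_infinite infinite_UNIV_char_0)
  then obtain e :: "real \<times> real \<Rightarrow> real" where e: "inj_on e (UNIV \<times> UNIV)"
    unfolding lepoll_def by blast
  define h :: "(real \<Rightarrow> (real \<times> 'a) set) \<Rightarrow> (real \<times> 'a) set"
    where "h f = {(t, a). \<exists>r s. t = e (r, s) \<and> (s, a) \<in> f r}" for f
  have h_iff: "(e (r, s), a) \<in> h f \<longleftrightarrow> (s, a) \<in> f r" for f r s a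
    using e unfolding h_def inj_on_def by blast
  have "inj h"
  proof (intro injI ext set_eqI)
    fix f g r and p :: "real \<times> 'a"
    assume eq: "h f = h g"
    obtain s a where p: "p = (s, a)" by (cases p)
    show "p \<in> f r \<longleftrightarrow> p \<in> g r"
      using h_iff[of r s a f] h_iff[of r s a g] unfolding p eq by blast
  qed
  then have "inj_on h ((UNIV :: real set) \<rightarrow>\<^sub>E A)" for A
    by (rule inj_on_subset) simp
  then have power: "((UNIV :: real set) \<rightarrow>\<^sub>E A) \<lesssim> (UNIV :: (real \<times> 'a) set set)"
    for A :: "(real \<times> 'a) set set"
    unfolding lepoll_def by (intro exI[of _ h]) simp
  have two: "\<exists>x\<in>UNIV. \<exists>y\<in>UNIV. (x :: (real \<times> 'a) set) \<noteq> y"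
    by (intro bexI[of _ "{}"] bexI[of _ UNIV]) (rule empty_not_UNIV, rule UNIV_I, rule UNIV_I)
  show ?thesis
    unfolding universe_def using power two by blast
qed

text \<open>Functions are extensional, so that equality of continuous maps is equality on the domain.\<close>

definition cmap :: "'a topology \<Rightarrow> 'b topology \<Rightarrow> ('a \<Rightarrow> 'b) set" where
  "cmap X Y = {f \<in> extensional (topspace X). continuous_map X Y f}"

definition is_space :: "'u set set \<Rightarrow> 'u topology \<Rightarrow> bool" where
  "is_space \<S> X \<longleftrightarrow> topspace X \<in> \<S>"

definition Top :: "'u set set \<Rightarrow> ('u topology, 'u \<Rightarrow> 'u) category" where
  "Top \<S> =
     \<lparr> Obj = {X. is_space \<S> X},
       Hom = cmap,
       Id = (\<lambda>X. restrict id (topspace X)),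
       Comp = (\<lambda>X Y Z g f. compose (topspace X) g f) \<rparr>"

text \<open>Pushouts and sequential colimits in \<open>Top \<S>\<close>, by their universal property.  The two spaces
  \<open>A\<close> and \<open>B\<close> of a span from \<open>A\<close> to \<open>X\<close> and \<open>B\<close> may live on other types; in the application they
  are sums of spheres and of discs.\<close>

definition is_pushout ::
  "'u set set \<Rightarrow> 'a topology \<Rightarrow> 'b topology \<Rightarrow> 'u topology \<Rightarrow> ('a \<Rightarrow> 'b) \<Rightarrow> ('a \<Rightarrow> 'u) \<Rightarrow>
   'u topology \<times> ('u \<Rightarrow> 'u) \<times> ('b \<Rightarrow> 'u) \<Rightarrow> bool" where
  "is_pushout \<S> A B X k g = (\<lambda>(Z, i, j).
     is_space \<S> Z \<and> i \<in> cmap X Z \<and> j \<in> cmap B Z \<and>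
     compose (topspace A) i g = compose (topspace A) j k \<and>
     (\<forall>W u v. is_space \<S> W \<and> u \<in> cmap X W \<and> v \<in> cmap B W \<and>
        compose (topspace A) u g = compose (topspace A) v k \<longrightarrow>
        (\<exists>!h. h \<in> cmap Z W \<and>
              compose (topspace X) h i = u \<and> compose (topspace B) h j = v)))"

definition is_seq_colimit ::
  "'u set set \<Rightarrow> (nat \<Rightarrow> 'u topology) \<Rightarrow> (nat \<Rightarrow> 'u \<Rightarrow> 'u) \<Rightarrow>
   'u topology \<times> (nat \<Rightarrow> 'u \<Rightarrow> 'u) \<Rightarrow> bool" where
  "is_seq_colimit \<S> X i = (\<lambda>(Z, j).
     is_space \<S> Z \<and> (\<forall>n. j n \<in> cmap (X n) Z) \<and>
     (\<forall>n. compose (topspace (X n)) (j (Suc n)) (i n) = j n) \<and>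
     (\<forall>W u. is_space \<S> W \<and> (\<forall>n. u n \<in> cmap (X n) W) \<and>
        (\<forall>n. compose (topspace (X n)) (u (Suc n)) (i n) = u n) \<longrightarrow>
        (\<exists>!h. h \<in> cmap Z W \<and> (\<forall>n. compose (topspace (X n)) h (j n) = u n))))"


section \<open>Strata\<close>

text \<open>The elements of \<open>\<J>\<close>, the inclusions of the sphere of dimension \<open>n - 1\<close> into the disc of
  dimension \<open>n\<close>, are represented by \<open>n\<close>.\<close>

definition disc :: "nat \<Rightarrow> (nat \<Rightarrow> real) topology" where
  "disc n = subtopology (Euclidean_space n) {x. (\<Sum>i<n. x i ^ 2) \<le> 1}"

definition disc_boundary :: "nat \<Rightarrow> (nat \<Rightarrow> real) topology" where
  "disc_boundary n = subtopology (Euclidean_space n) {x. (\<Sum>i<n. x i ^ 2) = 1}"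

lemma disc_boundary_0: "topspace (disc_boundary 0) = {}"
  by (simp add: disc_boundary_def)

lemma disc_boundary_Suc: "disc_boundary (Suc n) = nsphere n"
  by (simp add: disc_boundary_def nsphere_def lessThan_Suc_atMost)

record 'u stratum =
  boundary :: "'u topology"
  cells :: "'u set"
  cell_dim :: "'u \<Rightarrow> nat"
  attach :: "'u \<Rightarrow> (nat \<Rightarrow> real) \<Rightarrow> 'u"

definition is_stratum :: "'u set set \<Rightarrow> 'u stratum \<Rightarrow> bool" where
  "is_stratum \<S> \<sigma> \<longleftrightarrow>
     is_space \<S> (boundary \<sigma>) \<and> cells \<sigma> \<in> \<S> \<and>
     cell_dim \<sigma> \<in> extensional (cells \<sigma>) \<and> attach \<sigma> \<in> extensional (cells \<sigma>) \<and>
     (\<forall>s\<in>cells \<sigma>. attach \<sigma> s \<in> cmap (disc_boundary (cell_dim \<sigma> s)) (boundary \<sigma>))"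

definition cell_boundaries :: "'u stratum \<Rightarrow> ('u \<times> (nat \<Rightarrow> real)) topology" where
  "cell_boundaries \<sigma> = sum_topology (\<lambda>s. disc_boundary (cell_dim \<sigma> s)) (cells \<sigma>)"

definition cell_discs :: "'u stratum \<Rightarrow> ('u \<times> (nat \<Rightarrow> real)) topology" where
  "cell_discs \<sigma> = sum_topology (\<lambda>s. disc (cell_dim \<sigma> s)) (cells \<sigma>)"

text \<open>A choice of pushout for each stratum: the body, with the maps into it from the boundary
  and from the sum of the discs.\<close>

definition body_cocone ::
  "'u set set \<Rightarrow> 'u stratum \<Rightarrow> 'u topology \<times> ('u \<Rightarrow> 'u) \<times> ('u \<times> (nat \<Rightarrow> real) \<Rightarrow> 'u)" where
  "body_cocone \<S> \<sigma> =
     (SOME P. is_pushout \<S> (cell_boundaries \<sigma>) (cell_discs \<sigma>) (boundary \<sigma>)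
                id (\<lambda>(s, x). attach \<sigma> s x) P)"

definition body :: "'u set set \<Rightarrow> 'u stratum \<Rightarrow> 'u topology" where
  "body \<S> \<sigma> = fst (body_cocone \<S> \<sigma>)"

definition body_incl :: "'u set set \<Rightarrow> 'u stratum \<Rightarrow> 'u \<Rightarrow> 'u" where
  "body_incl \<S> \<sigma> = fst (snd (body_cocone \<S> \<sigma>))"

definition body_char :: "'u set set \<Rightarrow> 'u stratum \<Rightarrow> 'u \<times> (nat \<Rightarrow> real) \<Rightarrow> 'u" where
  "body_char \<S> \<sigma> = snd (snd (body_cocone \<S> \<sigma>))"

definition stratum_hom :: "'u stratum \<Rightarrow> 'u stratum \<Rightarrow> (('u \<Rightarrow> 'u) \<times> ('u \<Rightarrow> 'u)) set" where
  "stratum_hom \<sigma> \<tau> =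
     {(f, p). f \<in> cmap (boundary \<sigma>) (boundary \<tau>) \<and> p \<in> cells \<sigma> \<rightarrow>\<^sub>E cells \<tau> \<and>
        (\<forall>s\<in>cells \<sigma>. cell_dim \<sigma> s = cell_dim \<tau> (p s) \<and>
           compose (topspace (disc_boundary (cell_dim \<sigma> s))) f (attach \<sigma> s) = attach \<tau> (p s))}"

definition body_map ::
  "'u set set \<Rightarrow> 'u stratum \<Rightarrow> 'u stratum \<Rightarrow> ('u \<Rightarrow> 'u) \<times> ('u \<Rightarrow> 'u) \<Rightarrow> 'u \<Rightarrow> 'u" where
  "body_map \<S> \<sigma> \<tau> = (\<lambda>(f, p). THE h. h \<in> cmap (body \<S> \<sigma>) (body \<S> \<tau>) \<and>
     compose (topspace (boundary \<sigma>)) h (body_incl \<S> \<sigma>) =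
       compose (topspace (boundary \<sigma>)) (body_incl \<S> \<tau>) f \<and>
     compose (topspace (cell_discs \<sigma>)) h (body_char \<S> \<sigma>) =
       compose (topspace (cell_discs \<sigma>)) (body_char \<S> \<tau>) (\<lambda>(s, x). (p s, x)))"


section \<open>Relative cell complexes\<close>

text \<open>The composite of the \<open>k\<close> maps from the boundary of stratum \<open>m\<close> to that of stratum \<open>m + k\<close>.\<close>

primrec iter_incl :: "'u set set \<Rightarrow> (nat \<Rightarrow> 'u stratum) \<Rightarrow> nat \<Rightarrow> nat \<Rightarrow> 'u \<Rightarrow> 'u" where
  "iter_incl \<S> K m 0 = restrict id (topspace (boundary (K m)))"
| "iter_incl \<S> K m (Suc k) =
     compose (topspace (boundary (K m))) (body_incl \<S> (K (m + k))) (iter_incl \<S> K m k)"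

definition connected_strata :: "'u set set \<Rightarrow> (nat \<Rightarrow> 'u stratum) \<Rightarrow> bool" where
  "connected_strata \<S> K \<longleftrightarrow> (\<forall>n. boundary (K (Suc n)) = body \<S> (K n))"

definition proper_strata :: "'u set set \<Rightarrow> (nat \<Rightarrow> 'u stratum) \<Rightarrow> bool" where
  "proper_strata \<S> K \<longleftrightarrow>
     \<not> (\<exists>n. \<exists>s\<in>cells (K n). \<exists>m<n.
          \<exists>c\<in>cmap (disc_boundary (cell_dim (K n) s)) (boundary (K m)).
            attach (K n) s =
            compose (topspace (disc_boundary (cell_dim (K n) s))) (iter_incl \<S> K m (n - m)) c)"

definition is_cell_complex :: "'u set set \<Rightarrow> (nat \<Rightarrow> 'u stratum) \<Rightarrow> bool" where
  "is_cell_complex \<S> K \<longleftrightarrow>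
     (\<forall>n. is_stratum \<S> (K n)) \<and> connected_strata \<S> K \<and> proper_strata \<S> K"

definition cell_complex_hom ::
  "'u set set \<Rightarrow> (nat \<Rightarrow> 'u stratum) \<Rightarrow> (nat \<Rightarrow> 'u stratum) \<Rightarrow>
   (nat \<Rightarrow> ('u \<Rightarrow> 'u) \<times> ('u \<Rightarrow> 'u)) set" where
  "cell_complex_hom \<S> K L =
     {\<phi>. (\<forall>n. \<phi> n \<in> stratum_hom (K n) (L n)) \<and>
         (\<forall>n. fst (\<phi> (Suc n)) = body_map \<S> (K n) (L n) (\<phi> n))}"

definition CellCx ::
  "'u set set \<Rightarrow> (nat \<Rightarrow> 'u stratum, nat \<Rightarrow> ('u \<Rightarrow> 'u) \<times> ('u \<Rightarrow> 'u)) category" where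
  "CellCx \<S> =
     \<lparr> Obj = {K. is_cell_complex \<S> K},
       Hom = cell_complex_hom \<S>,
       Id = (\<lambda>K n. (restrict id (topspace (boundary (K n))), restrict id (cells (K n)))),
       Comp = (\<lambda>K L M \<psi> \<phi> n.
                 (compose (topspace (boundary (K n))) (fst (\<psi> n)) (fst (\<phi> n)),
                  compose (cells (K n)) (snd (\<psi> n)) (snd (\<phi> n)))) \<rparr>"

definition complex_cocone ::
  "'u set set \<Rightarrow> (nat \<Rightarrow> 'u stratum) \<Rightarrow> 'u topology \<times> (nat \<Rightarrow> 'u \<Rightarrow> 'u)" where
  "complex_cocone \<S> K =
     (SOME P. is_seq_colimit \<S> (\<lambda>n. boundary (K n)) (\<lambda>n. body_incl \<S> (K n)) P)"

definition complex_body :: "'u set set \<Rightarrow> (nat \<Rightarrow> 'u stratum) \<Rightarrow> 'u topology" where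
  "complex_body \<S> K = fst (complex_cocone \<S> K)"

definition complex_incl :: "'u set set \<Rightarrow> (nat \<Rightarrow> 'u stratum) \<Rightarrow> nat \<Rightarrow> 'u \<Rightarrow> 'u" where
  "complex_incl \<S> K = snd (complex_cocone \<S> K)"

definition complex_body_map ::
  "'u set set \<Rightarrow> (nat \<Rightarrow> 'u stratum) \<Rightarrow> (nat \<Rightarrow> 'u stratum) \<Rightarrow>
   (nat \<Rightarrow> ('u \<Rightarrow> 'u) \<times> ('u \<Rightarrow> 'u)) \<Rightarrow> 'u \<Rightarrow> 'u" where
  "complex_body_map \<S> K L \<phi> = (THE h. h \<in> cmap (complex_body \<S> K) (complex_body \<S> L) \<and>
     (\<forall>n. compose (topspace (boundary (K n))) h (complex_incl \<S> K n) =
          compose (topspace (boundary (K n))) (complex_incl \<S> L n) (fst (\<phi> n))))"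

definition U_CellCx ::
  "'u set set \<Rightarrow>
   (nat \<Rightarrow> 'u stratum, nat \<Rightarrow> ('u \<Rightarrow> 'u) \<times> ('u \<Rightarrow> 'u),
    'u topology \<times> 'u topology \<times> ('u \<Rightarrow> 'u), ('u \<Rightarrow> 'u) \<times> ('u \<Rightarrow> 'u)) functor_data" where
  "U_CellCx \<S> =
     \<lparr> ObjMap = (\<lambda>K. (boundary (K 0), complex_body \<S> K, complex_incl \<S> K 0)),
       ArrMap = (\<lambda>K L \<phi>. (fst (\<phi> 0), complex_body_map \<S> K L \<phi>)) \<rparr>"

end

theory Submission
  imports Defs
begin

text \<open>The right adjoint sends a map \<open>f\<close> from \<open>A\<close> to \<open>B\<close> to the relative cell complex over \<open>B\<close>
  that is obtained from \<open>A\<close> by attaching as many cells as possible. The first stratum has one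
  cell for each commutative square from a sphere inclusion to \<open>f\<close>, the lower maps of the squares
  extend \<open>f\<close> to a map from the body of this stratum to \<open>B\<close>, and the construction is repeated with
  that map. From the second stratum on, squares are omitted whose upper map factors through the
  previous stage, so that the complex is proper. This is the small object argument without
  redundant cells.

  A morphism from a complex \<open>K\<close> to this one over a given square from \<open>U K\<close> to \<open>f\<close> exists and is
  unique, by induction over the strata. Once the map on boundaries is known, a cell of \<open>K\<close> with
  its attaching map determines a square over \<open>B\<close> (\<open>cell_square_hom\<close>), and the cells of the target
  correspond bijectively to squares, so there is exactly one cell to which it can go. The only
  thing to check is that this square has not been omitted. This holds because a morphism of
  strata maps open cells to open cells, and boundaries are subspaces of bodies: if the image of
  an attaching map factors through the previous stage of the target, then the attaching map
  already factors through the previous stage of \<open>K\<close> (\<open>factors_if_body_map_factors\<close>), which its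
  properness excludes. Hence there is a universal arrow from \<open>U\<close> to each \<open>f\<close>
  (\<open>universal_arrow_exists\<close>), and that is enough for a right adjoint
  (\<open>has_right_adjoint_if_universal_arrows\<close>).

  Bodies and colimits are arbitrary choices among the objects with the universal property. It has
  to be shown that such objects exist in the universe (\<open>quotient_exists\<close>). What is needed about
  the points and the topology of a body is then derived from the universal property alone, with
  maps to spaces with two points.\<close>

section \<open>Right adjoints from universal arrows\<close>

lemma category_Id: "\<lbrakk>is_category C; X \<in> Obj C\<rbrakk> \<Longrightarrow> Id C X \<in> Hom C X X"
  and category_Comp: "\<lbrakk>is_category C; X \<in> Obj C; Y \<in> Obj C; Z \<in> Obj C; f \<in> Hom C X Y; g \<in> Hom C Y Z\<rbrakk>
    \<Longrightarrow> Comp C X Y Z g f \<in> Hom C X Z"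
  and category_Id_right: "\<lbrakk>is_category C; X \<in> Obj C; Y \<in> Obj C; f \<in> Hom C X Y\<rbrakk>
    \<Longrightarrow> Comp C X X Y f (Id C X) = f"
  and category_Id_left: "\<lbrakk>is_category C; X \<in> Obj C; Y \<in> Obj C; f \<in> Hom C X Y\<rbrakk>
    \<Longrightarrow> Comp C X Y Y (Id C Y) f = f"
  and category_assoc: "\<lbrakk>is_category C; W \<in> Obj C; X \<in> Obj C; Y \<in> Obj C; Z \<in> Obj C;
      f \<in> Hom C W X; g \<in> Hom C X Y; h \<in> Hom C Y Z\<rbrakk>
    \<Longrightarrow> Comp C W Y Z h (Comp C W X Y g f) = Comp C W X Z (Comp C X Y Z h g) f"
  unfolding is_category_def by blast+

lemma functor_Obj: "\<lbrakk>is_functor C D F; X \<in> Obj C\<rbrakk> \<Longrightarrow> ObjMap F X \<in> Obj D"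
  and functor_Arr: "\<lbrakk>is_functor C D F; X \<in> Obj C; Y \<in> Obj C; f \<in> Hom C X Y\<rbrakk>
    \<Longrightarrow> ArrMap F X Y f \<in> Hom D (ObjMap F X) (ObjMap F Y)"
  and functor_Id: "\<lbrakk>is_functor C D F; X \<in> Obj C\<rbrakk> \<Longrightarrow> ArrMap F X X (Id C X) = Id D (ObjMap F X)"
  and functor_Comp: "\<lbrakk>is_functor C D F; X \<in> Obj C; Y \<in> Obj C; Z \<in> Obj C;
      f \<in> Hom C X Y; g \<in> Hom C Y Z\<rbrakk>
    \<Longrightarrow> ArrMap F X Z (Comp C X Y Z g f) =
      Comp D (ObjMap F X) (ObjMap F Y) (ObjMap F Z) (ArrMap F Y Z g) (ArrMap F X Y f)"
  unfolding is_functor_def by blast+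

text \<open>A universal arrow \<open>e\<close> from \<open>F\<close> to \<open>Y\<close>, with domain \<open>F R\<close>, is a component of the counit, and
  \<open>R\<close> is the value of the right adjoint at \<open>Y\<close>. Everything else is forced: every law asserts the
  equality of two morphisms into some \<open>R\<close>, and such morphisms are equal once their images under
  \<open>F\<close> agree after composition with \<open>e\<close>.\<close>

lemma has_right_adjoint_if_universal_arrows:
  assumes F: "is_functor C D F"
    and universal_arrow: "\<And>Y. Y \<in> Obj D \<Longrightarrow>
      \<exists>R\<in>Obj C. \<exists>e\<in>Hom D (ObjMap F R) Y. \<forall>X\<in>Obj C. \<forall>g\<in>Hom D (ObjMap F X) Y.
        \<exists>!h. h \<in> Hom C X R \<and> Comp D (ObjMap F X) (ObjMap F R) Y e (ArrMap F X R h) = g"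
  shows "has_right_adjoint C D F"
proof -
  define arrow where "arrow Y R e \<longleftrightarrow> R \<in> Obj C \<and> e \<in> Hom D (ObjMap F R) Y \<and>
    (\<forall>X\<in>Obj C. \<forall>g\<in>Hom D (ObjMap F X) Y.
      \<exists>!h. h \<in> Hom C X R \<and> Comp D (ObjMap F X) (ObjMap F R) Y e (ArrMap F X R h) = g)" for Y R e
  have "\<forall>Y\<in>Obj D. \<exists>R e. arrow Y R e"
    using universal_arrow unfolding arrow_def by blast
  then obtain R e where Re: "arrow Y (R Y) (e Y)" if "Y \<in> Obj D" for Y
    by metis
  have R: "R Y \<in> Obj C" and e: "e Y \<in> Hom D (ObjMap F (R Y)) Y" if "Y \<in> Obj D" for Y
    using Re[OF that] by (simp_all add: arrow_def)
  have univ: "\<exists>!h. h \<in> Hom C X (R Y) \<and>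
      Comp D (ObjMap F X) (ObjMap F (R Y)) Y (e Y) (ArrMap F X (R Y) h) = g"
    if "Y \<in> Obj D" "X \<in> Obj C" "g \<in> Hom D (ObjMap F X) Y" for X Y g
    using Re[OF that(1)] that(2,3) by (simp add: arrow_def)
  have C: "is_category C" and D: "is_category D"
    using F unfolding is_functor_def by blast+
  define counit where
    "counit X Y h = Comp D (ObjMap F X) (ObjMap F (R Y)) Y (e Y) (ArrMap F X (R Y) h)" for X Y h
  define tr where "tr X Y g = (THE h. h \<in> Hom C X (R Y) \<and> counit X Y h = g)" for X Y g
  have tr: "tr X Y g \<in> Hom C X (R Y) \<and> counit X Y (tr X Y g) = g"
    if "Y \<in> Obj D" "X \<in> Obj C" "g \<in> Hom D (ObjMap F X) Y" for X Y g
    unfolding tr_def by (rule theI') (use univ[OF that] in \<open>unfold counit_def\<close>)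
  have tr_eq: "tr X Y g = h"
    if "Y \<in> Obj D" "X \<in> Obj C" "g \<in> Hom D (ObjMap F X) Y" "h \<in> Hom C X (R Y)" "counit X Y h = g"
    for X Y g h
    using univ[OF that(1-3)] tr[OF that(1-3)] that(4,5) unfolding counit_def by blast
  have counit_Hom: "counit X Y h \<in> Hom D (ObjMap F X) Y"
    if "Y \<in> Obj D" "X \<in> Obj C" "h \<in> Hom C X (R Y)" for X Y h
    unfolding counit_def
    by (rule category_Comp[OF D]) (use that F in \<open>auto intro: functor_Obj functor_Arr R e\<close>)
  have counit_Comp: "counit X' Y (Comp C X' X (R Y) h k) =
      Comp D (ObjMap F X') (ObjMap F X) Y (counit X Y h) (ArrMap F X' X k)"
    if "Y \<in> Obj D" "X \<in> Obj C" "X' \<in> Obj C" "h \<in> Hom C X (R Y)" "k \<in> Hom C X' X" for X X' Y h k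
    unfolding counit_def
    by (subst functor_Comp[OF F], (use that R in auto)[5],
        rule category_assoc[OF D]) (use that F in \<open>auto intro: functor_Obj functor_Arr R e\<close>)
  define A where "A Y Y' k = tr (R Y) Y' (Comp D (ObjMap F (R Y)) Y Y' k (e Y))" for Y Y' k
  have ke: "Comp D (ObjMap F (R Y)) Y Y' k (e Y) \<in> Hom D (ObjMap F (R Y)) Y'"
    if "Y \<in> Obj D" "Y' \<in> Obj D" "k \<in> Hom D Y Y'" for Y Y' k
    by (rule category_Comp[OF D]) (use that F in \<open>auto intro: functor_Obj R e\<close>)
  have A: "A Y Y' k \<in> Hom C (R Y) (R Y')"
     "counit (R Y) Y' (A Y Y' k) = Comp D (ObjMap F (R Y)) Y Y' k (e Y)"
    if "Y \<in> Obj D" "Y' \<in> Obj D" "k \<in> Hom D Y Y'" for Y Y' k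
    unfolding A_def using tr[OF that(2) R[OF that(1)] ke[OF that]] by auto
  have nat: "counit X Y' (Comp C X (R Y) (R Y') (A Y Y' k) h)
      = Comp D (ObjMap F X) Y Y' k (counit X Y h)"
    if "X \<in> Obj C" "Y \<in> Obj D" "Y' \<in> Obj D" "k \<in> Hom D Y Y'" "h \<in> Hom C X (R Y)" for X Y Y' k h
  proof -
    have "counit X Y' (Comp C X (R Y) (R Y') (A Y Y' k) h) =
        Comp D (ObjMap F X) (ObjMap F (R Y)) Y' (Comp D (ObjMap F (R Y)) Y Y' k (e Y))
          (ArrMap F X (R Y) h)"
      using that A by (simp add: counit_Comp R)
    also have "\<dots> = Comp D (ObjMap F X) Y Y' k (counit X Y h)"
      unfolding counit_def
      by (rule category_assoc[OF D, symmetric])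
        (use that F in \<open>auto intro: functor_Obj functor_Arr R e\<close>)
    finally show ?thesis .
  qed
  define G where "G = \<lparr> ObjMap = R, ArrMap = A \<rparr>"
  have GA: "A Y Y' k = h" if "Y \<in> Obj D" "Y' \<in> Obj D" "k \<in> Hom D Y Y'" "h \<in> Hom C (R Y) (R Y')"
    "counit (R Y) Y' h = Comp D (ObjMap F (R Y)) Y Y' k (e Y)" for Y Y' k h
    unfolding A_def by (rule tr_eq) (use that R ke in auto)
  have G: "is_functor D C G"
    unfolding is_functor_def G_def functor_data.simps
  proof (intro conjI ballI C D R A)
    fix Y assume Y: "Y \<in> Obj D"
    have "counit (R Y) Y (Id C (R Y)) = e Y"
      unfolding counit_def using Y R F by (simp add: functor_Id category_Id_right[OF D] functor_Obj e)
    then show "A Y Y (Id D Y) = Id C (R Y)"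
      using Y R F by (intro GA)
       (auto intro: category_Id[OF C] category_Id[OF D] simp: category_Id_left[OF D] functor_Obj e)
  next
    fix X Y Z f g
    assume *: "X \<in> Obj D" "Y \<in> Obj D" "Z \<in> Obj D" "f \<in> Hom D X Y" "g \<in> Hom D Y Z"
    have "counit (R X) Z (Comp C (R X) (R Y) (R Z) (A Y Z g) (A X Y f)) =
      Comp D (ObjMap F (R X)) X Z (Comp D X Y Z g f) (e X)"
      using * A R by (simp add: nat category_assoc[OF D] functor_Obj[OF F] e)
    then show "A X Z (Comp D X Y Z g f) = Comp C (R X) (R Y) (R Z) (A Y Z g) (A X Y f)"
      using * R by (intro GA) (auto intro!: A category_Comp[OF C] category_Comp[OF D])
  qed
  have "adjunction C D F G tr"
    unfolding adjunction_def
  proof (intro conjI ballI F G)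
    fix X Y assume *: "X \<in> Obj C" "Y \<in> Obj D"
    show "bij_betw (tr X Y) (Hom D (ObjMap F X) Y) (Hom C X (ObjMap G Y))"
      by (rule bij_betw_byWitness[where f' = "counit X Y"])
        (use * tr tr_eq counit_Hom in \<open>auto simp: G_def\<close>)
  next
    fix X' X Y Y' h g k
    assume *: "X' \<in> Obj C" "X \<in> Obj C" "Y \<in> Obj D" "Y' \<in> Obj D"
       "h \<in> Hom C X' X" "g \<in> Hom D (ObjMap F X) Y" "k \<in> Hom D Y Y'"
    let ?gh = "Comp D (ObjMap F X') (ObjMap F X) Y g (ArrMap F X' X h)"
    have gh: "?gh \<in> Hom D (ObjMap F X') Y"
      by (rule category_Comp[OF D]) (use * F in \<open>auto intro: functor_Obj functor_Arr\<close>)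
    have tg: "tr X Y g \<in> Hom C X (R Y)" "counit X Y (tr X Y g) = g"
      using tr * by auto
    have th: "Comp C X' X (R Y) (tr X Y g) h \<in> Hom C X' (R Y)"
      using * tg R by (auto intro: category_Comp[OF C])
    show "tr X' Y' (Comp D (ObjMap F X') Y Y' k ?gh) =
      Comp C X' (ObjMap G Y) (ObjMap G Y') (ArrMap G Y Y' k)
          (Comp C X' X (ObjMap G Y) (tr X Y g) h)"
      unfolding G_def functor_data.simps
    proof (rule tr_eq)
      show "counit X' Y' (Comp C X' (R Y) (R Y') (A Y Y' k) (Comp C X' X (R Y) (tr X Y g) h)) =
         Comp D (ObjMap F X') Y Y' k ?gh"
        using * th tg by (simp add: nat counit_Comp)
    qed (use * gh th A R F in \<open>auto intro!: category_Comp[OF C] category_Comp[OF D] functor_Obj\<close>)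
  qed
  then show ?thesis unfolding has_right_adjoint_def by blast
qed


section \<open>Extensional continuous maps\<close>

lemma cmap_eqI: "\<lbrakk>f \<in> cmap X Y; g \<in> cmap X Z; \<And>x. x \<in> topspace X \<Longrightarrow> f x = g x\<rbrakk> \<Longrightarrow> f = g"
  unfolding cmap_def by (auto intro: extensionalityI)

lemma cmap_in: "\<lbrakk>f \<in> cmap X Y; x \<in> topspace X\<rbrakk> \<Longrightarrow> f x \<in> topspace Y"
  unfolding cmap_def continuous_map_def by auto

lemma cmap_imp_continuous_map: "f \<in> cmap X Y \<Longrightarrow> continuous_map X Y f"
  unfolding cmap_def by auto

lemma restrict_in_cmap_iff: "restrict f (topspace X) \<in> cmap X Y \<longleftrightarrow> continuous_map X Y f"
  unfolding cmap_def by (auto intro: continuous_map_eq)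

lemma id_in_cmap: "restrict id (topspace X) \<in> cmap X X"
  by (simp add: restrict_in_cmap_iff)

lemma compose_in_cmap: "\<lbrakk>f \<in> cmap X Y; g \<in> cmap Y Z\<rbrakk> \<Longrightarrow> compose (topspace X) g f \<in> cmap X Z"
  using restrict_in_cmap_iff[of "g \<circ> f" X Z] continuous_map_compose[of X Y f Z g]
  by (simp add: compose_def comp_def cmap_imp_continuous_map)

lemma compose_eq_iff: "compose A g f = compose A g' f' \<longleftrightarrow> (\<forall>x\<in>A. g (f x) = g' (f' x))"
  unfolding compose_def by (auto simp: fun_eq_iff restrict_def)

lemma compose_eq_cmap_iff:
  "u \<in> cmap X Y \<Longrightarrow> compose (topspace X) g f = u \<longleftrightarrow> (\<forall>x\<in>topspace X. g (f x) = u x)"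
  unfolding compose_def cmap_def by (auto simp: fun_eq_iff restrict_def extensional_def)

lemma continuous_map_sum_topology:
  "continuous_map (sum_topology X I) Y f \<longleftrightarrow> (\<forall>i\<in>I. continuous_map (X i) Y (\<lambda>x. f (i, x)))"
proof -
  have "{x. (i, x) \<in> {p \<in> Sigma I (topspace \<circ> X). f p \<in> V}} = {x \<in> topspace (X i). f (i, x) \<in> V}"
    if "i \<in> I" for i V
    using that by auto
  then have "openin (sum_topology X I) {p \<in> Sigma I (topspace \<circ> X). f p \<in> V} \<longleftrightarrow>
      (\<forall>i\<in>I. openin (X i) {x \<in> topspace (X i). f (i, x) \<in> V})" for V
    unfolding openin_sum_topology by (simp cong: ball_cong)
  then show ?thesis
    unfolding continuous_map_def topspace_sum_topology Pi_iff by fastforce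
qed

text \<open>Indiscrete and Sierpinski spaces are used as test objects: maps to the former are arbitrary
  functions, and maps to the latter are open subsets. A property of a colimit can then be read
  off from its universal property, whichever colimit was chosen.\<close>

definition indiscrete :: "'a set \<Rightarrow> 'a topology" where
  "indiscrete A = topology (\<lambda>U. U = {} \<or> U = A)"

lemma openin_indiscrete: "openin (indiscrete A) U \<longleftrightarrow> U = {} \<or> U = A"
proof -
  have "istopology (\<lambda>U. U = {} \<or> U = A)"
    unfolding istopology_def by auto
  then show ?thesis by (simp add: indiscrete_def)
qed

lemma topspace_indiscrete [simp]: "topspace (indiscrete A) = A"
  unfolding topspace_def by (auto simp: openin_indiscrete)

lemma continuous_map_indiscrete:
  "continuous_map X (indiscrete A) f \<longleftrightarrow> (\<forall>x\<in>topspace X. f x \<in> A)"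
proof -
  have "{x \<in> topspace X. f x \<in> A} = topspace X" if "\<forall>x\<in>topspace X. f x \<in> A"
    using that by blast
  then show ?thesis
    unfolding continuous_map_def by (auto simp: openin_indiscrete)
qed

definition sierpinski :: "'a \<Rightarrow> 'a \<Rightarrow> 'a topology" where
  "sierpinski a b = topology (\<lambda>U. U = {} \<or> U = {b} \<or> U = {a, b})"

lemma openin_sierpinski: "openin (sierpinski a b) U \<longleftrightarrow> U = {} \<or> U = {b} \<or> U = {a, b}"
proof -
  have "istopology (\<lambda>U. U = {} \<or> U = {b} \<or> U = {a, b})"
    unfolding istopology_def
  proof (intro conjI allI impI)
    fix K assume "\<forall>U\<in>K. U = {} \<or> U = {b} \<or> U = {a, b}"
    then show "\<Union> K = {} \<or> \<Union> K = {b} \<or> \<Union> K = {a, b}"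
      by (cases "{a,b} \<in> K"; cases "{b} \<in> K") blast+
  qed auto
  then show ?thesis by (simp add: sierpinski_def)
qed

lemma topspace_sierpinski [simp]: "topspace (sierpinski a b) = {a, b}"
  unfolding topspace_def openin_sierpinski by blast

lemma continuous_map_sierpinski:
  assumes "a \<noteq> b"
  shows "continuous_map X (sierpinski a b) f \<longleftrightarrow>
    (\<forall>x\<in>topspace X. f x \<in> {a, b}) \<and> openin X {x \<in> topspace X. f x = b}"
proof -
  have "{x \<in> topspace X. f x = a \<or> f x = b} = topspace X" if "\<forall>x\<in>topspace X. f x = a \<or> f x = b"
    using that by blast
  then show ?thesis
    using assms unfolding continuous_map_def by (auto simp: openin_sierpinski)
qed


section \<open>Small sets\<close>

text \<open>Constructions that leave the type \<open>'u\<close> (sums, products, sets of functions) are carried out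
  on their natural types; only the cardinality matters, since a set that embeds into a member of
  the universe can be renamed to a member of it (\<open>small_encode\<close>).\<close>

definition small :: "'u set set \<Rightarrow> 'a set \<Rightarrow> bool" where
  "small \<S> A \<longleftrightarrow> (\<exists>B\<in>\<S>. A \<lesssim> B)"

lemma real_functions_lepoll: "(UNIV :: (nat \<Rightarrow> real) set) \<lesssim> (UNIV :: real set)"
proof -
  obtain e :: "real \<Rightarrow> nat set" where e: "inj e"
    using nat_sets_eqpoll_reals[THEN eqpoll_sym, THEN eqpoll_imp_lepoll] unfolding lepoll_def by blast
  define h where "h x = {prod_encode (i, k) |i k. k \<in> e (x i)}" for x :: "nat \<Rightarrow> real"
  have "inj h"
  proof (intro injI ext)
    fix x y i assume eq: "h x = h y"
    have "k \<in> e (z i) \<longleftrightarrow> prod_encode (i, k) \<in> h z" for k z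
      unfolding h_def by auto
    then have "e (x i) = e (y i)"
      using eq by auto
    then show "x i = y i"
      using e by (auto dest: injD)
  qed
  then have "(UNIV :: (nat \<Rightarrow> real) set) \<lesssim> (UNIV :: nat set set)"
    unfolding lepoll_def by auto
  then show ?thesis
    using nat_sets_eqpoll_reals lepoll_trans2 by blast
qed

locale small_universe =
  fixes \<S> :: "'u set set"
  assumes univ: "universe \<S>"
begin

lemma small_subset_iff: "small \<S> A \<longleftrightarrow> A \<in> \<S>" for A :: "'u set"
  using univ unfolding small_def universe_def by blast

lemma small_lepoll: "\<lbrakk>small \<S> B; A \<lesssim> B\<rbrakk> \<Longrightarrow> small \<S> A"
  unfolding small_def by (meson lepoll_trans)

lemma small_subset: "\<lbrakk>small \<S> B; A \<subseteq> B\<rbrakk> \<Longrightarrow> small \<S> A"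
  using small_lepoll subset_imp_lepoll by blast

lemma small_image: "small \<S> A \<Longrightarrow> small \<S> (f ` A)"
  using small_lepoll image_lepoll by blast

lemma small_encode:
  assumes "small \<S> A"
  obtains e :: "'a \<Rightarrow> 'u" where "inj_on e A" "e ` A \<in> \<S>"
proof -
  obtain B where B: "B \<in> \<S>" "A \<lesssim> B" using assms unfolding small_def by blast
  then obtain e where e: "inj_on e A" "e ` A \<subseteq> B" unfolding lepoll_def by blast
  then have "e ` A \<in> \<S>"
    using B by (metis small_subset_iff small_subset)
  with e that show ?thesis by blast
qed

lemma two_points: obtains a b where "a \<noteq> b" "{a, b} \<in> \<S>"
proof -
  obtain A a b where "A \<in> \<S>" "a \<in> A" "b \<in> A" "a \<noteq> b"
    using univ unfolding universe_def by blast
  then show ?thesis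
    using that[of a b] small_subset[of A "{a, b}"] small_subset_iff by auto
qed

lemma small_Union: "(\<And>n :: nat. A n \<in> \<S>) \<Longrightarrow> (\<Union>n. A n) \<in> \<S>"
  using univ unfolding universe_def by blast

lemma small_real_functions:
  assumes "small \<S> A"
  shows "small \<S> ((UNIV :: real set) \<rightarrow>\<^sub>E A)"
proof -
  obtain B where B: "B \<in> \<S>" "A \<lesssim> B" using assms unfolding small_def by blast
  then obtain C where "C \<in> \<S>" "((UNIV :: real set) \<rightarrow>\<^sub>E B) \<lesssim> C"
    using univ unfolding universe_def by blast
  then show ?thesis
    unfolding small_def using lepoll_funcset_right[OF \<open>A \<lesssim> B\<close>] lepoll_trans by blast
qed

lemma small_reals: "small \<S> (UNIV :: real set)"
proof -
  obtain a b where ab: "a \<noteq> b" "{a, b} \<in> \<S>" by (rule two_points)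
  \<comment> \<open>The characteristic functions of the singletons, with values in a two-element set.\<close>
  define f where "f r = (\<lambda>s. if s = r then a else b)" for r :: real
  have "inj f"
  proof
    fix r r' assume "f r = f r'"
    then have "f r r = f r' r" by simp
    then show "r = r'" using ab unfolding f_def by (auto split: if_splits)
  qed
  then have "(UNIV :: real set) \<lesssim> ((UNIV :: real set) \<rightarrow>\<^sub>E {a, b})"
    unfolding lepoll_def by (intro exI[of _ f]) (auto simp: f_def)
  then show ?thesis
    using small_lepoll small_real_functions ab small_subset_iff by blast
qed

lemma small_Plus:
  assumes "small \<S> A" "small \<S> B"
  shows "small \<S> (A <+> B)"
proof -
  obtain A' B' where *: "A' \<in> \<S>" "A \<lesssim> A'" "B' \<in> \<S>" "B \<lesssim> B'"
    using assms unfolding small_def by blast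
  obtain a b where ab: "a \<noteq> b" "{a, b} \<in> \<S>" by (rule two_points)
  define E where "E n = (if n = 0 then A' else if n = (1 :: nat) then B' else {a, b})" for n
  define C where "C = (\<Union>n. E n)"
  have "C \<in> \<S>"
    unfolding C_def by (rule small_Union) (use * ab in \<open>auto simp: E_def\<close>)
  have "E n \<subseteq> C" for n unfolding C_def by blast
  from this[of 0] this[of 1] this[of 2] have sub: "A' \<subseteq> C" "B' \<subseteq> C" "a \<in> C" "b \<in> C"
    by (auto simp: E_def)
  obtain f g where fg: "inj_on f A" "f ` A \<subseteq> A'" "inj_on g B" "g ` B \<subseteq> B'"
    using * unfolding lepoll_def by blast
  \<comment> \<open>The value at 0 is the element and the value at 1 its side; \<open>C\<close> contains copies of both
    summands and the two points that mark the sides.\<close>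
  define h where
    "h z r = (case z of Inl x \<Rightarrow> if r = 0 then f x else a | Inr y \<Rightarrow> if r = 0 then g y else b)" for z and r :: real
  have "inj_on h (A <+> B)"
  proof (rule inj_onI)
    fix z z' assume z: "z \<in> A <+> B" "z' \<in> A <+> B" "h z = h z'"
    then have "h z 0 = h z' 0" "h z 1 = h z' 1" by auto
    then show "z = z'"
      using z(1,2) fg ab by (auto simp: h_def inj_on_def split: sum.splits)
  qed
  moreover have "h ` (A <+> B) \<subseteq> UNIV \<rightarrow>\<^sub>E C"
    using sub fg by (auto simp: h_def PiE_iff image_subset_iff split: sum.splits)
  ultimately have "(A <+> B) \<lesssim> ((UNIV :: real set) \<rightarrow>\<^sub>E C)"
    unfolding lepoll_def by blast
  moreover have "small \<S> C"
    using \<open>C \<in> \<S>\<close> by (simp add: small_subset_iff)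
  ultimately show ?thesis
    using small_lepoll small_real_functions by blast
qed

lemma small_Times:
  fixes A :: "'a set" and B :: "'b set"
  assumes A: "small \<S> A" and B: "small \<S> B"
  shows "small \<S> (A \<times> B)"
proof -
  \<comment> \<open>A pair is a function on a two-element set, here padded to one on the reals.\<close>
  define h :: "'a \<times> 'b \<Rightarrow> real \<Rightarrow> 'a + 'b"
    where "h = (\<lambda>(x, y) r. if r = 0 then Inl x else Inr y)"
  have "inj_on h (A \<times> B)"
  proof (rule inj_onI)
    fix z z' assume "h z = h z'"
    then have "h z 0 = h z' 0" "h z 1 = h z' 1" by auto
    then show "z = z'" by (auto simp: h_def split: prod.splits)
  qed
  then have "A \<times> B \<lesssim> ((UNIV :: real set) \<rightarrow>\<^sub>E (A <+> B))"
    unfolding lepoll_def by (intro exI[of _ h]) (auto simp: h_def)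
  then show ?thesis
    by (rule small_lepoll[OF small_real_functions[OF small_Plus[OF A B]]])
qed

lemma small_nat: "small \<S> (UNIV :: nat set)"
  using small_reals small_lepoll infinite_le_lepoll infinite_UNIV_char_0 by blast

lemma small_nat_real: "small \<S> (A :: (nat \<Rightarrow> real) set)"
  using small_lepoll[OF small_reals real_functions_lepoll] small_subset by blast

lemma small_Sigma_nat:
  assumes A: "\<And>n :: nat. small \<S> (A n)"
  shows "small \<S> (Sigma UNIV A)"
proof -
  have "\<exists>e. inj_on e (A n) \<and> e ` A n \<in> \<S>" for n
    using small_encode[OF A[of n]] by blast
  then obtain e where e: "\<And>n. inj_on (e n) (A n)" "\<And>n. e n ` A n \<in> \<S>"
    by metis
  have "small \<S> (\<Union>n. e n ` A n)"
    using small_Union[of "\<lambda>n. e n ` A n"] e(2) by (simp add: small_subset_iff)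
  then have "small \<S> ((UNIV :: nat set) \<times> (\<Union>n. e n ` A n))"
    by (rule small_Times[OF small_nat])
  moreover have "Sigma UNIV A \<lesssim> (UNIV :: nat set) \<times> (\<Union>n. e n ` A n)"
    unfolding lepoll_def
    by (rule exI[of _ "\<lambda>(n, a). (n, e n a)"]) (use e(1) in \<open>auto simp: inj_on_def\<close>)
  ultimately show ?thesis by (rule small_lepoll)
qed

text \<open>Sets of maps out of discs and spheres are bounded by this, and with them the number of
  cells that a single stratum of the classifying complex needs.\<close>

lemma small_extensional_functions:
  assumes "small \<S> A"
  shows "small \<S> ((D :: (nat \<Rightarrow> real) set) \<rightarrow>\<^sub>E A)"
proof -
  have "D \<lesssim> (UNIV :: (nat \<Rightarrow> real) set)"
    by (rule subset_imp_lepoll) simp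
  then have D: "D \<lesssim> (UNIV :: real set)"
    by (rule lepoll_trans[OF _ real_functions_lepoll])
  show ?thesis
  proof (cases "A = {}")
    case True
    then have "(D \<rightarrow>\<^sub>E A) \<subseteq> {\<lambda>_. undefined}"
      by (auto simp: PiE_eq_empty_iff) 
    moreover have "small \<S> {\<lambda>_ :: nat \<Rightarrow> real. undefined :: 'b}"
      using small_image[OF small_nat, of "\<lambda>_. \<lambda>_. undefined"] by simp
    ultimately show ?thesis by (rule small_subset[rotated])
  next
    case False
    then have "(D \<rightarrow>\<^sub>E A) \<lesssim> ((UNIV :: real set) \<rightarrow>\<^sub>E A)"
      by (intro lepoll_funcset_left D) auto
    then show ?thesis
      using small_real_functions[OF assms] small_lepoll by blast
  qed
qed


section \<open>Pushouts and sequential colimits\<close>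

text \<open>The coequaliser of a relation on a space \<open>P\<close>, with the underlying set renamed into the
  universe. Points are identified when every function to \<open>'u\<close> that respects \<open>R\<close> takes the same
  value at them: every such function factors through this equivalence relation by construction.
  Pushouts and sequential colimits are both obtained from a disjoint sum in this way.\<close>

lemma quotient_exists:
  fixes P :: "'a topology" and R :: "('a \<times> 'a) set"
  assumes small: "small \<S> (topspace P)"
  obtains Z :: "'u topology" and q where "is_space \<S> Z" "continuous_map P Z q"
    "\<And>x y. (x, y) \<in> R \<Longrightarrow> q x = q y"
    "\<And>W u. \<lbrakk>continuous_map P W u; \<And>x y. (x, y) \<in> R \<Longrightarrow> u x = (u y :: 'u)\<rbrakk> \<Longrightarrow>
       \<exists>!h. h \<in> cmap Z W \<and> (\<forall>x\<in>topspace P. h (q x) = u x)"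
proof -
  obtain e :: "'a \<Rightarrow> 'u" where e: "inj_on e (topspace P)" "e ` topspace P \<in> \<S>"
    by (rule small_encode[OF small])
  define resp where "resp f \<longleftrightarrow> (\<forall>(x, y)\<in>R. f x = f y)" for f :: "'a \<Rightarrow> 'u"
  define eqv where "eqv x y \<longleftrightarrow> (\<forall>f. resp f \<longrightarrow> f x = f y)" for x y
  \<comment> \<open>The quotient set is represented by a choice of points, renamed by \<open>e\<close>.\<close>
  define rep where "rep x = (SOME y. y \<in> topspace P \<and> eqv x y)" for x
  have rep: "rep x \<in> topspace P \<and> eqv x (rep x)" if "x \<in> topspace P" for x
    unfolding rep_def by (rule someI[of _ x]) (use that in \<open>simp add: eqv_def\<close>)
  have rep_eq: "rep x = rep y" if "(x, y) \<in> R" for x y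
  proof -
    have "f x = f y" if "resp f" for f
      using that \<open>(x, y) \<in> R\<close> by (auto simp: resp_def)
    then have "eqv x z \<longleftrightarrow> eqv y z" for z
      unfolding eqv_def by metis
    then have "eqv x = eqv y" by (intro ext)
    then show ?thesis by (simp add: rep_def)
  qed
  define q where "q x = e (rep x)" for x
  \<comment> \<open>The finest topology that makes \<open>q\<close> continuous.\<close>
  define Z where "Z = topology (\<lambda>U. U \<subseteq> q ` topspace P \<and> openin P {x \<in> topspace P. q x \<in> U})"
  have "istopology (\<lambda>U. U \<subseteq> q ` topspace P \<and> openin P {x \<in> topspace P. q x \<in> U})"
    unfolding istopology_def
  proof (intro conjI allI impI)
    fix U V
    assume "U \<subseteq> q ` topspace P \<and> openin P {x \<in> topspace P. q x \<in> U}"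
      and "V \<subseteq> q ` topspace P \<and> openin P {x \<in> topspace P. q x \<in> V}"
    then have "openin P ({x \<in> topspace P. q x \<in> U} \<inter> {x \<in> topspace P. q x \<in> V})"
      by auto
    also have "{x \<in> topspace P. q x \<in> U} \<inter> {x \<in> topspace P. q x \<in> V} = {x \<in> topspace P. q x \<in> U \<inter> V}"
      by auto
    finally show "openin P {x \<in> topspace P. q x \<in> U \<inter> V}" .
  next
    fix K
    assume "\<forall>U\<in>K. U \<subseteq> q ` topspace P \<and> openin P {x \<in> topspace P. q x \<in> U}"
    then have "openin P (\<Union>U\<in>K. {x \<in> topspace P. q x \<in> U})"
      by blast
    also have "(\<Union>U\<in>K. {x \<in> topspace P. q x \<in> U}) = {x \<in> topspace P. q x \<in> \<Union> K}"
      by auto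
    finally show "openin P {x \<in> topspace P. q x \<in> \<Union> K}" .
  qed blast+
  then have open_Z: "openin Z U \<longleftrightarrow> U \<subseteq> q ` topspace P \<and> openin P {x \<in> topspace P. q x \<in> U}" for U
    by (simp add: Z_def)
  have "{x \<in> topspace P. q x \<in> q ` topspace P} = topspace P" by auto
  then have "openin Z (q ` topspace P)" by (simp add: open_Z)
  then have top_Z: "topspace Z = q ` topspace P"
    by (meson open_Z openin_subset openin_topspace subset_antisym)
  have "topspace Z \<subseteq> e ` topspace P"
    unfolding top_Z q_def using rep by auto
  then have "is_space \<S> Z"
    unfolding is_space_def using e small_subset small_subset_iff by blast
  moreover have "continuous_map P Z q"
    unfolding continuous_map_def by (auto simp: open_Z top_Z)
  moreover have "q x = q y" if "(x, y) \<in> R" for x y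
    using rep_eq[OF that] by (simp add: q_def)
  moreover have "\<exists>!h. h \<in> cmap Z W \<and> (\<forall>x\<in>topspace P. h (q x) = u x)"
    if u: "continuous_map P W u" and uR: "\<And>x y. (x, y) \<in> R \<Longrightarrow> u x = u y" for W and u :: "'a \<Rightarrow> 'u"
  proof (rule ex_ex1I)
    have "resp u" unfolding resp_def using uR by blast
    then have u_rep: "u (rep x) = u x" if "x \<in> topspace P" for x
      using rep[OF that] \<open>resp u\<close> unfolding eqv_def by metis
    have u_q: "u x = u y" if "x \<in> topspace P" "y \<in> topspace P" "q x = q y" for x y
      using that rep u_rep inj_onD[OF e(1)] unfolding q_def by metis
    define h where "h z = u (inv_into (topspace P) q z)" for z
    have h: "h (q x) = u x" if "x \<in> topspace P" for x
      unfolding h_def using that by (intro u_q) (auto intro: inv_into_into simp: f_inv_into_f)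
    have "continuous_map Z W h"
      unfolding continuous_map_def
    proof (intro conjI allI impI funcsetI)
      show "h z \<in> topspace W" if "z \<in> topspace Z" for z
        using that h u by (auto simp: top_Z continuous_map_def)
      fix U assume "openin W U"
      moreover have "{x \<in> topspace P. q x \<in> {z \<in> topspace Z. h z \<in> U}} = {x \<in> topspace P. u x \<in> U}"
        by (intro Collect_cong conj_cong refl) (simp add: h top_Z)
      ultimately show "openin Z {z \<in> topspace Z. h z \<in> U}"
        using u by (auto simp: open_Z top_Z continuous_map_def)
    qed
    then show "\<exists>h. h \<in> cmap Z W \<and> (\<forall>x\<in>topspace P. h (q x) = u x)"
      using h restrict_in_cmap_iff[of h Z W]
      by (intro exI[of _ "restrict h (topspace Z)"]) (simp add: top_Z)
    show "h = h'" if "h \<in> cmap Z W \<and> (\<forall>x\<in>topspace P. h (q x) = u x)"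
      "h' \<in> cmap Z W \<and> (\<forall>x\<in>topspace P. h' (q x) = u x)" for h h'
      using that by (intro cmap_eqI[of h Z W h' W]) (auto simp: top_Z)
  qed
  ultimately show ?thesis using that by blast
qed

lemma is_pushout_pointwise:
  "is_pushout \<S> A B X k g (Z, i, j) \<longleftrightarrow>
     is_space \<S> Z \<and> i \<in> cmap X Z \<and> j \<in> cmap B Z \<and> (\<forall>x\<in>topspace A. i (g x) = j (k x)) \<and>
     (\<forall>W u v. is_space \<S> W \<and> u \<in> cmap X W \<and> v \<in> cmap B W \<and> (\<forall>x\<in>topspace A. u (g x) = v (k x)) \<longrightarrow>
        (\<exists>!h. h \<in> cmap Z W \<and> (\<forall>x\<in>topspace X. h (i x) = u x) \<and> (\<forall>x\<in>topspace B. h (j x) = v x)))"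
proof -
  have "(\<exists>!h. h \<in> cmap Z W \<and> compose (topspace X) h i = u \<and> compose (topspace B) h j = v) \<longleftrightarrow>
      (\<exists>!h. h \<in> cmap Z W \<and> (\<forall>x\<in>topspace X. h (i x) = u x) \<and> (\<forall>x\<in>topspace B. h (j x) = v x))"
    if "is_space \<S> W \<and> u \<in> cmap X W \<and> v \<in> cmap B W \<and> (\<forall>x\<in>topspace A. u (g x) = v (k x))" for W u v
    using that by (simp add: compose_eq_cmap_iff[of u X W] compose_eq_cmap_iff[of v B W])
  then show ?thesis
    unfolding is_pushout_def prod.case compose_eq_iff
    by (intro conj_cong refl all_cong1 imp_cong)
qed

lemma is_seq_colimit_pointwise:
  "is_seq_colimit \<S> X i (Z, j) \<longleftrightarrow>
     is_space \<S> Z \<and> (\<forall>n. j n \<in> cmap (X n) Z) \<and> (\<forall>n. \<forall>x\<in>topspace (X n). j (Suc n) (i n x) = j n x) \<and>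
     (\<forall>W u. is_space \<S> W \<and> (\<forall>n. u n \<in> cmap (X n) W) \<and>
        (\<forall>n. \<forall>x\<in>topspace (X n). u (Suc n) (i n x) = u n x) \<longrightarrow>
        (\<exists>!h. h \<in> cmap Z W \<and> (\<forall>n. \<forall>x\<in>topspace (X n). h (j n x) = u n x)))"
proof -
  have compat: "(\<forall>n. compose (topspace (X n)) (u (Suc n)) (i n) = u n) \<longleftrightarrow>
      (\<forall>n. \<forall>x\<in>topspace (X n). u (Suc n) (i n x) = u n x)" if "\<forall>n. u n \<in> cmap (X n) W" for W u
    using that by (simp add: compose_eq_cmap_iff[of "u _" "X _" W])
  have "(\<exists>!h. h \<in> cmap Z W \<and> (\<forall>n. compose (topspace (X n)) h (j n) = u n)) \<longleftrightarrow>
      (\<exists>!h. h \<in> cmap Z W \<and> (\<forall>n. \<forall>x\<in>topspace (X n). h (j n x) = u n x))"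
    if "is_space \<S> W \<and> (\<forall>n. u n \<in> cmap (X n) W) \<and>
        (\<forall>n. \<forall>x\<in>topspace (X n). u (Suc n) (i n x) = u n x)" for W u
    using that by (simp add: compose_eq_cmap_iff[of "u _" "X _" W])
  then show ?thesis
    unfolding is_seq_colimit_def prod.case
    by (intro conj_cong refl all_cong1 imp_cong compat)
qed

definition disjoint_sum :: "'a topology \<Rightarrow> 'b topology \<Rightarrow> ('a + 'b) topology" where
  "disjoint_sum X Y = topology (\<lambda>U. openin X (Inl -` U) \<and> openin Y (Inr -` U))"

lemma openin_disjoint_sum:
  "openin (disjoint_sum X Y) U \<longleftrightarrow> openin X (Inl -` U) \<and> openin Y (Inr -` U)"
proof -
  have "istopology (\<lambda>U. openin X (Inl -` U) \<and> openin Y (Inr -` U))"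
    unfolding istopology_def vimage_Int vimage_Union by blast
  then show ?thesis by (simp add: disjoint_sum_def)
qed

lemma topspace_disjoint_sum: "topspace (disjoint_sum X Y) = topspace X <+> topspace Y"
proof
  show "topspace (disjoint_sum X Y) \<subseteq> topspace X <+> topspace Y"
  proof
    fix z assume "z \<in> topspace (disjoint_sum X Y)"
    then obtain U where "openin X (Inl -` U)" "openin Y (Inr -` U)" "z \<in> U"
      using openin_disjoint_sum unfolding topspace_def by blast
    then show "z \<in> topspace X <+> topspace Y"
      by (cases z) (auto dest!: openin_subset)
  qed
  have "Inl -` (topspace X <+> topspace Y) = topspace X" "Inr -` (topspace X <+> topspace Y) = topspace Y"
    by auto
  then show "topspace X <+> topspace Y \<subseteq> topspace (disjoint_sum X Y)"
    by (intro openin_subset) (simp add: openin_disjoint_sum)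
qed

lemma continuous_map_disjoint_sum:
  "continuous_map (disjoint_sum X Y) Z f \<longleftrightarrow>
     continuous_map X Z (\<lambda>x. f (Inl x)) \<and> continuous_map Y Z (\<lambda>y. f (Inr y))"
proof -
  have "Inl -` {z \<in> topspace X <+> topspace Y. f z \<in> V} = {x \<in> topspace X. f (Inl x) \<in> V}"
    "Inr -` {z \<in> topspace X <+> topspace Y. f z \<in> V} = {y \<in> topspace Y. f (Inr y) \<in> V}" for V
    by auto
  then show ?thesis
    unfolding continuous_map_def topspace_disjoint_sum openin_disjoint_sum
    by (auto simp: Pi_iff)
qed

lemma pushout_exists:
  fixes X :: "'u topology" and A :: "'a topology" and B :: "'b topology"
  assumes X: "is_space \<S> X" and B: "small \<S> (topspace B)"
    and g: "\<And>x. x \<in> topspace A \<Longrightarrow> g x \<in> topspace X"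
    and k: "\<And>x. x \<in> topspace A \<Longrightarrow> k x \<in> topspace B"
  shows "\<exists>P. is_pushout \<S> A B X k g P"
proof -
  define R :: "(('u + 'b) \<times> ('u + 'b)) set"
    where "R = {(Inl (g x), Inr (k x)) |x. x \<in> topspace A}"
  have "small \<S> (topspace (disjoint_sum X B))"
    using X B by (simp add: topspace_disjoint_sum small_Plus is_space_def small_subset_iff)
  then obtain Z :: "'u topology" and q where Z: "is_space \<S> Z" "continuous_map (disjoint_sum X B) Z q"
    and qR: "\<And>x y. (x, y) \<in> R \<Longrightarrow> q x = q y"
    and univ_q: "\<And>W u. \<lbrakk>continuous_map (disjoint_sum X B) W u; \<And>x y. (x, y) \<in> R \<Longrightarrow> u x = (u y :: 'u)\<rbrakk> \<Longrightarrow>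
       \<exists>!h. h \<in> cmap Z W \<and> (\<forall>x\<in>topspace (disjoint_sum X B). h (q x) = u x)"
    by (rule quotient_exists[where R = R]) blast
  have q: "q (Inl (g x)) = q (Inr (k x))" if "x \<in> topspace A" for x
    using that by (intro qR) (auto simp: R_def)
  define i where "i = restrict (\<lambda>x. q (Inl x)) (topspace X)"
  define j where "j = restrict (\<lambda>y. q (Inr y)) (topspace B)"
  have "\<exists>!h. h \<in> cmap Z W \<and> (\<forall>x\<in>topspace X. h (i x) = u x) \<and> (\<forall>x\<in>topspace B. h (j x) = v x)"
    if uv: "u \<in> cmap X W" "v \<in> cmap B W" "\<forall>x\<in>topspace A. u (g x) = v (k x)"
    for W :: "'u topology" and u v
  proof -
    have "\<exists>!h. h \<in> cmap Z W \<and> (\<forall>z\<in>topspace (disjoint_sum X B). h (q z) = case_sum u v z)"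
      by (rule univ_q)
        (use uv in \<open>auto simp: continuous_map_disjoint_sum cmap_imp_continuous_map R_def\<close>)
    moreover have "(\<forall>z\<in>topspace (disjoint_sum X B). h (q z) = case_sum u v z) \<longleftrightarrow>
        (\<forall>x\<in>topspace X. h (i x) = u x) \<and> (\<forall>x\<in>topspace B. h (j x) = v x)" for h
      unfolding i_def j_def topspace_disjoint_sum by (auto simp: Plus_def)
    ultimately show ?thesis by simp
  qed
  moreover have "i \<in> cmap X Z" "j \<in> cmap B Z"
    unfolding i_def j_def restrict_in_cmap_iff using Z continuous_map_disjoint_sum by blast+
  moreover have "\<forall>x\<in>topspace A. i (g x) = j (k x)"
    by (simp add: i_def j_def g k q)
  ultimately have "is_pushout \<S> A B X k g (Z, i, j)"
    unfolding is_pushout_pointwise using Z by simp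
  then show ?thesis by blast
qed

lemma seq_colimit_exists:
  fixes X :: "nat \<Rightarrow> 'u topology"
  assumes X: "\<And>n. is_space \<S> (X n)" and i: "\<And>n. i n \<in> cmap (X n) (X (Suc n))"
  shows "\<exists>P. is_seq_colimit \<S> X i P"
proof -
  define R where "R = {((n, x), (Suc n, i n x)) |n x. x \<in> topspace (X n)}"
  let ?P = "sum_topology X UNIV"
  have "small \<S> (topspace ?P)"
    using X small_Sigma_nat[of "\<lambda>n. topspace (X n)"] by (simp add: is_space_def comp_def small_subset_iff)
  then obtain Z :: "'u topology" and q where Z: "is_space \<S> Z" "continuous_map ?P Z q"
    and qR: "\<And>x y. (x, y) \<in> R \<Longrightarrow> q x = q y"
    and univ_q: "\<And>W u. \<lbrakk>continuous_map ?P W u; \<And>x y. (x, y) \<in> R \<Longrightarrow> u x = (u y :: 'u)\<rbrakk> \<Longrightarrow>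
       \<exists>!h. h \<in> cmap Z W \<and> (\<forall>x\<in>topspace ?P. h (q x) = u x)"
    by (rule quotient_exists[where R = R]) blast
  have q: "q (Suc n, i n x) = q (n, x)" if "x \<in> topspace (X n)" for n x
    by (rule qR[symmetric]) (use that in \<open>auto simp: R_def\<close>)
  define j where "j n = restrict (\<lambda>x. q (n, x)) (topspace (X n))" for n
  have "\<exists>!h. h \<in> cmap Z W \<and> (\<forall>n. \<forall>x\<in>topspace (X n). h (j n x) = u n x)"
    if u: "\<forall>n. u n \<in> cmap (X n) W" "\<forall>n. \<forall>x\<in>topspace (X n). u (Suc n) (i n x) = u n x"
    for W :: "'u topology" and u
  proof -
    have "\<exists>!h. h \<in> cmap Z W \<and> (\<forall>z\<in>topspace ?P. h (q z) = case_prod u z)"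
      by (rule univ_q)
        (use u in \<open>auto simp: continuous_map_sum_topology cmap_imp_continuous_map R_def\<close>)
    moreover have "(\<forall>z\<in>topspace ?P. h (q z) = case_prod u z) \<longleftrightarrow>
        (\<forall>n. \<forall>x\<in>topspace (X n). h (j n x) = u n x)" for h
      unfolding j_def by auto
    ultimately show ?thesis by simp
  qed
  moreover have "j n \<in> cmap (X n) Z" for n
    unfolding j_def restrict_in_cmap_iff using Z(2) by (simp add: continuous_map_sum_topology)
  moreover have "j (Suc n) (i n x) = j n x" if "x \<in> topspace (X n)" for n x
    using that cmap_in[OF i that] by (simp add: j_def q)
  ultimately have "is_seq_colimit \<S> X i (Z, j)"
    unfolding is_seq_colimit_pointwise using Z by simp
  then show ?thesis by blast
qed

end

context small_universe begin

section \<open>The body of a stratum\<close>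

lemma disc_boundary_subtopology: "disc_boundary d = subtopology (disc d) {x. (\<Sum>i<d. x i ^ 2) = 1}"
  unfolding disc_boundary_def disc_def subtopology_subtopology by (rule arg_cong) auto

lemma disc_boundary_subset: "topspace (disc_boundary d) \<subseteq> topspace (disc d)"
  unfolding disc_boundary_subtopology by simp

lemma topspace_cell_discs: "topspace (cell_discs \<sigma>) = (SIGMA s:cells \<sigma>. topspace (disc (cell_dim \<sigma> s)))"
  and topspace_cell_boundaries:
    "topspace (cell_boundaries \<sigma>) = (SIGMA s:cells \<sigma>. topspace (disc_boundary (cell_dim \<sigma> s)))"
  unfolding cell_discs_def cell_boundaries_def by (simp_all add: comp_def)

lemma stratum_attach:
  "\<lbrakk>is_stratum \<S> \<sigma>; s \<in> cells \<sigma>\<rbrakk> \<Longrightarrow> attach \<sigma> s \<in> cmap (disc_boundary (cell_dim \<sigma> s)) (boundary \<sigma>)"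
  unfolding is_stratum_def by blast

lemma attach_in:
  "\<lbrakk>is_stratum \<S> \<sigma>; s \<in> cells \<sigma>; x \<in> topspace (disc_boundary (cell_dim \<sigma> s))\<rbrakk>
    \<Longrightarrow> attach \<sigma> s x \<in> topspace (boundary \<sigma>)"
  by (rule cmap_in[OF stratum_attach])

lemma body_pushout:
  assumes "is_stratum \<S> \<sigma>"
  shows "is_pushout \<S> (cell_boundaries \<sigma>) (cell_discs \<sigma>) (boundary \<sigma>) id (\<lambda>(s, x). attach \<sigma> s x)
    (body \<S> \<sigma>, body_incl \<S> \<sigma>, body_char \<S> \<sigma>)"
proof -
  have "small \<S> (cells \<sigma> \<times> (UNIV :: (nat \<Rightarrow> real) set))"
    using assms by (intro small_Times small_nat_real) (simp add: is_stratum_def small_subset_iff)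
  then have "small \<S> (topspace (cell_discs \<sigma>))"
    by (rule small_subset) (auto simp: topspace_cell_discs)
  then have "\<exists>P. is_pushout \<S> (cell_boundaries \<sigma>) (cell_discs \<sigma>) (boundary \<sigma>) id (\<lambda>(s, x). attach \<sigma> s x) P"
    using assms disc_boundary_subset attach_in[OF assms]
    by (intro pushout_exists)
      (auto simp: topspace_cell_discs topspace_cell_boundaries is_stratum_def)
  then show ?thesis
    unfolding body_def body_incl_def body_char_def body_cocone_def prod.collapse by (rule someI_ex)
qed

context
  fixes \<sigma> :: "'u stratum"
  assumes \<sigma>: "is_stratum \<S> \<sigma>"
begin

lemma body_space: "is_space \<S> (body \<S> \<sigma>)"
  and body_incl: "body_incl \<S> \<sigma> \<in> cmap (boundary \<sigma>) (body \<S> \<sigma>)"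
  and body_char: "body_char \<S> \<sigma> \<in> cmap (cell_discs \<sigma>) (body \<S> \<sigma>)"
  using body_pushout[OF \<sigma>] unfolding is_pushout_pointwise by simp_all

lemma body_char_continuous:
  "s \<in> cells \<sigma> \<Longrightarrow> continuous_map (disc (cell_dim \<sigma> s)) (body \<S> \<sigma>) (\<lambda>x. body_char \<S> \<sigma> (s, x))"
  using body_char[THEN cmap_imp_continuous_map]
  by (simp add: cell_discs_def continuous_map_sum_topology)

lemma body_glue:
  "\<lbrakk>s \<in> cells \<sigma>; x \<in> topspace (disc_boundary (cell_dim \<sigma> s))\<rbrakk>
    \<Longrightarrow> body_incl \<S> \<sigma> (attach \<sigma> s x) = body_char \<S> \<sigma> (s, x)"
  using body_pushout[OF \<sigma>] unfolding is_pushout_pointwise by (auto simp: topspace_cell_boundaries)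

lemma body_universal:
  assumes W: "is_space \<S> W" and u: "continuous_map (boundary \<sigma>) W u"
    and v: "\<And>s. s \<in> cells \<sigma> \<Longrightarrow> continuous_map (disc (cell_dim \<sigma> s)) W (v s)"
    and uv: "\<And>s x. \<lbrakk>s \<in> cells \<sigma>; x \<in> topspace (disc_boundary (cell_dim \<sigma> s))\<rbrakk> \<Longrightarrow> u (attach \<sigma> s x) = v s x"
  shows "\<exists>!h. h \<in> cmap (body \<S> \<sigma>) W \<and> (\<forall>x\<in>topspace (boundary \<sigma>). h (body_incl \<S> \<sigma> x) = u x) \<and>
    (\<forall>s\<in>cells \<sigma>. \<forall>x\<in>topspace (disc (cell_dim \<sigma> s)). h (body_char \<S> \<sigma> (s, x)) = v s x)"
proof -
  let ?u = "restrict u (topspace (boundary \<sigma>))"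
  let ?v = "restrict (\<lambda>(s, x). v s x) (topspace (cell_discs \<sigma>))"
  have "?u \<in> cmap (boundary \<sigma>) W"
    by (simp add: restrict_in_cmap_iff u)
  moreover have "?v \<in> cmap (cell_discs \<sigma>) W"
    unfolding restrict_in_cmap_iff by (simp add: cell_discs_def continuous_map_sum_topology v)
  moreover have "\<forall>z\<in>topspace (cell_boundaries \<sigma>). ?u ((\<lambda>(s, x). attach \<sigma> s x) z) = ?v (id z)"
    using disc_boundary_subset attach_in[OF \<sigma>]
    by (auto simp: topspace_cell_discs topspace_cell_boundaries uv)
  ultimately have "\<exists>!h. h \<in> cmap (body \<S> \<sigma>) W \<and>
      (\<forall>x\<in>topspace (boundary \<sigma>). h (body_incl \<S> \<sigma> x) = ?u x) \<and>
      (\<forall>z\<in>topspace (cell_discs \<sigma>). h (body_char \<S> \<sigma> z) = ?v z)"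
    using body_pushout[OF \<sigma>] W unfolding is_pushout_pointwise by blast
  moreover have "(\<forall>z\<in>topspace (cell_discs \<sigma>). h (body_char \<S> \<sigma> z) = ?v z) \<longleftrightarrow>
      (\<forall>s\<in>cells \<sigma>. \<forall>x\<in>topspace (disc (cell_dim \<sigma> s)). h (body_char \<S> \<sigma> (s, x)) = v s x)" for h
    by (auto simp: topspace_cell_discs)
  ultimately show ?thesis by simp
qed

text \<open>Compare two maps from the body to an indiscrete space with two points: one is constant, the
  other singles out the complement of the images of boundary and discs. They agree on those
  images, hence everywhere, so the complement is empty.\<close>

lemma body_cases:
  assumes "z \<in> topspace (body \<S> \<sigma>)"
  obtains (boundary) x where "x \<in> topspace (boundary \<sigma>)" "z = body_incl \<S> \<sigma> x"
  | (interior) s x where "s \<in> cells \<sigma>" "x \<in> topspace (disc (cell_dim \<sigma> s))"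
      "x \<notin> topspace (disc_boundary (cell_dim \<sigma> s))" "z = body_char \<S> \<sigma> (s, x)"
proof -
  obtain a b :: 'u where ab: "a \<noteq> b" "{a, b} \<in> \<S>" by (rule two_points)
  let ?W = "indiscrete {a, b}"
  define I where "I = body_incl \<S> \<sigma> ` topspace (boundary \<sigma>) \<union> body_char \<S> \<sigma> ` topspace (cell_discs \<sigma>)"
  define h where "h = restrict (\<lambda>z. if z \<in> I then a else b) (topspace (body \<S> \<sigma>))"
  define h' where "h' = restrict (\<lambda>z. a) (topspace (body \<S> \<sigma>))"
  have "\<exists>!h. h \<in> cmap (body \<S> \<sigma>) ?W \<and> (\<forall>x\<in>topspace (boundary \<sigma>). h (body_incl \<S> \<sigma> x) = a) \<and>
    (\<forall>s\<in>cells \<sigma>. \<forall>x\<in>topspace (disc (cell_dim \<sigma> s)). h (body_char \<S> \<sigma> (s, x)) = a)"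
    by (rule body_universal) (auto simp: is_space_def ab continuous_map_indiscrete)
  moreover have "h \<in> cmap (body \<S> \<sigma>) ?W" "h' \<in> cmap (body \<S> \<sigma>) ?W"
    unfolding h_def h'_def restrict_in_cmap_iff by (auto simp: continuous_map_indiscrete)
  moreover have "h (body_incl \<S> \<sigma> x) = a" "h' (body_incl \<S> \<sigma> x) = a" if "x \<in> topspace (boundary \<sigma>)" for x
    using that cmap_in[OF body_incl that] by (auto simp: h_def h'_def I_def)
  moreover have "h (body_char \<S> \<sigma> (s, x)) = a" "h' (body_char \<S> \<sigma> (s, x)) = a"
    if "s \<in> cells \<sigma>" "x \<in> topspace (disc (cell_dim \<sigma> s))" for s x
  proof -
    have "(s, x) \<in> topspace (cell_discs \<sigma>)" using that by (simp add: topspace_cell_discs)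
    from this cmap_in[OF body_char this] show "h (body_char \<S> \<sigma> (s, x)) = a" "h' (body_char \<S> \<sigma> (s, x)) = a"
      by (auto simp: h_def h'_def I_def)
  qed
  ultimately have "h = h'" by blast
  then have "h z = h' z" by simp
  then have "z \<in> I"
    using assms ab by (auto simp: h_def h'_def split: if_splits)
  then consider x where "x \<in> topspace (boundary \<sigma>)" "z = body_incl \<S> \<sigma> x"
    | s x where "s \<in> cells \<sigma>" "x \<in> topspace (disc (cell_dim \<sigma> s))" "z = body_char \<S> \<sigma> (s, x)"
    unfolding I_def topspace_cell_discs by auto
  then show ?thesis
  proof cases
    case (2 s x)
    show ?thesis
    proof (cases "x \<in> topspace (disc_boundary (cell_dim \<sigma> s))")
      case True
      then show ?thesis
        using 2 body_glue[of s x] attach_in[OF \<sigma>, of s x] that(1) by simp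
    qed (use 2 that in blast)
  qed (use that in blast)
qed

lemma body_eqI:
  assumes "h \<in> cmap (body \<S> \<sigma>) W" "h' \<in> cmap (body \<S> \<sigma>) W'"
    and "\<And>x. x \<in> topspace (boundary \<sigma>) \<Longrightarrow> h (body_incl \<S> \<sigma> x) = h' (body_incl \<S> \<sigma> x)"
    and "\<And>s x. \<lbrakk>s \<in> cells \<sigma>; x \<in> topspace (disc (cell_dim \<sigma> s))\<rbrakk>
      \<Longrightarrow> h (body_char \<S> \<sigma> (s, x)) = h' (body_char \<S> \<sigma> (s, x))"
  shows "h = h'"
  using assms(1,2) by (rule cmap_eqI) (erule body_cases; simp add: assms(3,4))

text \<open>The function that takes one value on the boundary and on the spheres and another one on the
  open discs respects the attaching maps, hence extends to the body and separates the two points.\<close>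

lemma body_char_interior:
  assumes s: "s \<in> cells \<sigma>" and x: "x \<in> topspace (disc (cell_dim \<sigma> s))"
    "x \<notin> topspace (disc_boundary (cell_dim \<sigma> s))" and y: "y \<in> topspace (boundary \<sigma>)"
  shows "body_char \<S> \<sigma> (s, x) \<noteq> body_incl \<S> \<sigma> y"
proof -
  obtain a b :: 'u where ab: "a \<noteq> b" "{a, b} \<in> \<S>" by (rule two_points)
  let ?v = "\<lambda>s x. if x \<in> topspace (disc_boundary (cell_dim \<sigma> s)) then a else b"
  have "\<exists>!h. h \<in> cmap (body \<S> \<sigma>) (indiscrete {a, b}) \<and>
    (\<forall>x\<in>topspace (boundary \<sigma>). h (body_incl \<S> \<sigma> x) = a) \<and>
    (\<forall>s\<in>cells \<sigma>. \<forall>x\<in>topspace (disc (cell_dim \<sigma> s)). h (body_char \<S> \<sigma> (s, x)) = ?v s x)"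
    by (rule body_universal) (auto simp: is_space_def ab continuous_map_indiscrete)
  then obtain h where "\<forall>x\<in>topspace (boundary \<sigma>). h (body_incl \<S> \<sigma> x) = a"
    "\<forall>s\<in>cells \<sigma>. \<forall>x\<in>topspace (disc (cell_dim \<sigma> s)). h (body_char \<S> \<sigma> (s, x)) = ?v s x"
    by blast
  then have "h (body_incl \<S> \<sigma> y) = a" "h (body_char \<S> \<sigma> (s, x)) = b"
    using s x y by auto
  then show ?thesis using ab by auto
qed

text \<open>The boundary carries the subspace topology of the body. The preimage of \<open>U\<close> in each sphere
  is the trace of an open subset of the disc, because the sphere is a subspace of the disc. These
  subsets, together with \<open>U\<close>, define a map from the body to the Sierpinski space.\<close>

lemma body_incl_open:
  assumes U: "openin (boundary \<sigma>) U"
  obtains V where "openin (body \<S> \<sigma>) V" "\<And>x. x \<in> topspace (boundary \<sigma>) \<Longrightarrow> body_incl \<S> \<sigma> x \<in> V \<longleftrightarrow> x \<in> U"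
proof -
  obtain a b :: 'u where ab: "a \<noteq> b" "{a, b} \<in> \<S>" by (rule two_points)
  have "\<forall>s. \<exists>O'. s \<in> cells \<sigma> \<longrightarrow> openin (disc (cell_dim \<sigma> s)) O' \<and>
      (\<forall>x\<in>topspace (disc_boundary (cell_dim \<sigma> s)). x \<in> O' \<longleftrightarrow> attach \<sigma> s x \<in> U)"
  proof
    fix s
    have "openin (disc_boundary (cell_dim \<sigma> s))
       {x \<in> topspace (disc_boundary (cell_dim \<sigma> s)). attach \<sigma> s x \<in> U}" if "s \<in> cells \<sigma>"
      using cmap_imp_continuous_map[OF stratum_attach[OF \<sigma> that]] U by (simp add: continuous_map_def)
    then obtain O' where "s \<in> cells \<sigma> \<longrightarrow> openin (disc (cell_dim \<sigma> s)) O' \<and>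
       {x \<in> topspace (disc_boundary (cell_dim \<sigma> s)). attach \<sigma> s x \<in> U} =
       O' \<inter> {x. (\<Sum>i<cell_dim \<sigma> s. x i ^ 2) = 1}"
      unfolding disc_boundary_subtopology openin_subtopology by blast
    then show "\<exists>O'. s \<in> cells \<sigma> \<longrightarrow> openin (disc (cell_dim \<sigma> s)) O' \<and>
      (\<forall>x\<in>topspace (disc_boundary (cell_dim \<sigma> s)). x \<in> O' \<longleftrightarrow> attach \<sigma> s x \<in> U)"
      by (intro exI[of _ O']) (auto simp: disc_boundary_subtopology)
  qed
  then obtain O' where O': "\<And>s. s \<in> cells \<sigma> \<Longrightarrow> openin (disc (cell_dim \<sigma> s)) (O' s)"
    "\<And>s x. \<lbrakk>s \<in> cells \<sigma>; x \<in> topspace (disc_boundary (cell_dim \<sigma> s))\<rbrakk> \<Longrightarrow> x \<in> O' s \<longleftrightarrow> attach \<sigma> s x \<in> U"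
    by metis
  have char_open: "continuous_map X (sierpinski a b) (\<lambda>x. if x \<in> V then b else a)" if "openin X V"
    for X :: "'c topology" and V
  proof -
    have "{x \<in> topspace X. (if x \<in> V then b else a) = b} = V"
      using ab openin_subset[OF that] by auto
    then show ?thesis using that by (simp add: continuous_map_sierpinski ab)
  qed
  have "\<exists>!h. h \<in> cmap (body \<S> \<sigma>) (sierpinski a b) \<and>
    (\<forall>x\<in>topspace (boundary \<sigma>). h (body_incl \<S> \<sigma> x) = (if x \<in> U then b else a)) \<and>
    (\<forall>s\<in>cells \<sigma>. \<forall>x\<in>topspace (disc (cell_dim \<sigma> s)). h (body_char \<S> \<sigma> (s, x)) = (if x \<in> O' s then b else a))"
    by (rule body_universal) (simp_all add: is_space_def ab char_open U O')
  then obtain h where h: "h \<in> cmap (body \<S> \<sigma>) (sierpinski a b)"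
    "\<forall>x\<in>topspace (boundary \<sigma>). h (body_incl \<S> \<sigma> x) = (if x \<in> U then b else a)"
    by blast
  let ?V = "{z \<in> topspace (body \<S> \<sigma>). h z = b}"
  have "openin (body \<S> \<sigma>) ?V"
    using cmap_imp_continuous_map[OF h(1)] by (simp add: continuous_map_sierpinski ab)
  moreover have "body_incl \<S> \<sigma> x \<in> ?V \<longleftrightarrow> x \<in> U" if "x \<in> topspace (boundary \<sigma>)" for x
    using that h(2) ab cmap_in[OF body_incl that] by simp
  ultimately show ?thesis using that by blast
qed

lemma factors_through_body_incl:
  assumes b: "b \<in> cmap D (body \<S> \<sigma>)" and img: "\<And>x. x \<in> topspace D \<Longrightarrow> b x \<in> body_incl \<S> \<sigma> ` topspace (boundary \<sigma>)"
  shows "\<exists>c\<in>cmap D (boundary \<sigma>). b = compose (topspace D) (body_incl \<S> \<sigma>) c"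
proof -
  \<comment> \<open>Any choice of preimages is continuous, because every open subset of the boundary is the
    preimage of an open subset of the body.\<close>
  define c where "c x = inv_into (topspace (boundary \<sigma>)) (body_incl \<S> \<sigma>) (b x)" for x
  have c: "c x \<in> topspace (boundary \<sigma>)" "body_incl \<S> \<sigma> (c x) = b x" if "x \<in> topspace D" for x
    using img[OF that] unfolding c_def by (auto intro: inv_into_into f_inv_into_f)
  have "continuous_map D (boundary \<sigma>) c"
    unfolding continuous_map_def
  proof (intro conjI allI impI funcsetI c)
    fix U assume "openin (boundary \<sigma>) U"
    then obtain V where V: "openin (body \<S> \<sigma>) V"
      "\<And>x. x \<in> topspace (boundary \<sigma>) \<Longrightarrow> body_incl \<S> \<sigma> x \<in> V \<longleftrightarrow> x \<in> U"
      by (rule body_incl_open) blast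
    have "{x \<in> topspace D. c x \<in> U} = {x \<in> topspace D. b x \<in> V}"
      using c V(2) by (metis (no_types, lifting))
    then show "openin D {x \<in> topspace D. c x \<in> U}"
      using V(1) cmap_imp_continuous_map[OF b] by (simp add: continuous_map_def)
  qed
  then have "restrict c (topspace D) \<in> cmap D (boundary \<sigma>)"
    by (simp add: restrict_in_cmap_iff)
  moreover have "b = compose (topspace D) (body_incl \<S> \<sigma>) (restrict c (topspace D))"
    using c by (intro cmap_eqI[OF b compose_in_cmap[OF calculation body_incl]]) (simp add: compose_def)
  ultimately show ?thesis by blast
qed

end

lemma stratum_hom_pointwise:
  assumes "is_stratum \<S> \<tau>"
  shows "\<phi> \<in> stratum_hom \<sigma> \<tau> \<longleftrightarrow>
    fst \<phi> \<in> cmap (boundary \<sigma>) (boundary \<tau>) \<and> snd \<phi> \<in> cells \<sigma> \<rightarrow>\<^sub>E cells \<tau> \<and>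
    (\<forall>s\<in>cells \<sigma>. cell_dim \<sigma> s = cell_dim \<tau> (snd \<phi> s) \<and>
      (\<forall>x\<in>topspace (disc_boundary (cell_dim \<sigma> s)). fst \<phi> (attach \<sigma> s x) = attach \<tau> (snd \<phi> s) x))"
proof -
  have "compose (topspace (disc_boundary (cell_dim \<sigma> s))) (fst \<phi>) (attach \<sigma> s) = attach \<tau> (snd \<phi> s) \<longleftrightarrow>
     (\<forall>x\<in>topspace (disc_boundary (cell_dim \<sigma> s)). fst \<phi> (attach \<sigma> s x) = attach \<tau> (snd \<phi> s) x)"
    if "snd \<phi> \<in> cells \<sigma> \<rightarrow>\<^sub>E cells \<tau>" "s \<in> cells \<sigma>" "cell_dim \<sigma> s = cell_dim \<tau> (snd \<phi> s)" for s
    using that stratum_attach[OF assms, of "snd \<phi> s"] by (intro compose_eq_cmap_iff) auto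
  then show ?thesis
    unfolding stratum_hom_def case_prod_beta by (auto cong: conj_cong)
qed

context
  fixes \<sigma> \<tau> :: "'u stratum"
  assumes \<sigma>: "is_stratum \<S> \<sigma>" and \<tau>: "is_stratum \<S> \<tau>"
begin

lemma body_map:
  assumes hom: "\<phi> \<in> stratum_hom \<sigma> \<tau>"
  shows body_map_in: "body_map \<S> \<sigma> \<tau> \<phi> \<in> cmap (body \<S> \<sigma>) (body \<S> \<tau>)" (is "?th1")
    and body_map_incl: "\<And>x. x \<in> topspace (boundary \<sigma>) \<Longrightarrow>
      body_map \<S> \<sigma> \<tau> \<phi> (body_incl \<S> \<sigma> x) = body_incl \<S> \<tau> (fst \<phi> x)" (is "\<And>x. _ x \<Longrightarrow> ?th2 x")
    and body_map_char: "\<And>s x. \<lbrakk>s \<in> cells \<sigma>; x \<in> topspace (disc (cell_dim \<sigma> s))\<rbrakk> \<Longrightarrow>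
      body_map \<S> \<sigma> \<tau> \<phi> (body_char \<S> \<sigma> (s, x)) = body_char \<S> \<tau> (snd \<phi> s, x)"
      (is "\<And>s x. \<lbrakk>_ s; _ s x\<rbrakk> \<Longrightarrow> ?th3 s x")
proof -
  note hom' = hom[unfolded stratum_hom_pointwise[OF \<tau>]]
  let ?h = "body_map \<S> \<sigma> \<tau> \<phi>"
  have "continuous_map (boundary \<sigma>) (body \<S> \<tau>) (\<lambda>x. body_incl \<S> \<tau> (fst \<phi> x))"
    using continuous_map_compose[of _ _ "fst \<phi>" _ "body_incl \<S> \<tau>"] hom' body_incl[OF \<tau>]
    by (auto simp: comp_def dest: cmap_imp_continuous_map)
  moreover have "continuous_map (disc (cell_dim \<sigma> s)) (body \<S> \<tau>) (\<lambda>x. body_char \<S> \<tau> (snd \<phi> s, x))"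
    if "s \<in> cells \<sigma>" for s
    using that hom' body_char_continuous[OF \<tau>, of "snd \<phi> s"] by auto
  moreover have "body_incl \<S> \<tau> (fst \<phi> (attach \<sigma> s x)) = body_char \<S> \<tau> (snd \<phi> s, x)"
    if "s \<in> cells \<sigma>" "x \<in> topspace (disc_boundary (cell_dim \<sigma> s))" for s x
    using that hom' body_glue[OF \<tau>, of "snd \<phi> s" x] by auto
  ultimately have "\<exists>!h. h \<in> cmap (body \<S> \<sigma>) (body \<S> \<tau>) \<and>
      (\<forall>x\<in>topspace (boundary \<sigma>). h (body_incl \<S> \<sigma> x) = body_incl \<S> \<tau> (fst \<phi> x)) \<and>
      (\<forall>s\<in>cells \<sigma>. \<forall>x\<in>topspace (disc (cell_dim \<sigma> s)). h (body_char \<S> \<sigma> (s, x)) = body_char \<S> \<tau> (snd \<phi> s, x))"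
    by (intro body_universal \<sigma> body_space \<tau>)
  then have "?h \<in> cmap (body \<S> \<sigma>) (body \<S> \<tau>) \<and>
      (\<forall>x\<in>topspace (boundary \<sigma>). ?h (body_incl \<S> \<sigma> x) = body_incl \<S> \<tau> (fst \<phi> x)) \<and>
      (\<forall>s\<in>cells \<sigma>. \<forall>x\<in>topspace (disc (cell_dim \<sigma> s)). ?h (body_char \<S> \<sigma> (s, x)) = body_char \<S> \<tau> (snd \<phi> s, x))"
    unfolding body_map_def case_prod_beta compose_eq_iff topspace_cell_discs split_paired_Ball_Sigma fst_conv snd_conv
    by (rule theI')
  then show ?th1 "\<And>x. x \<in> topspace (boundary \<sigma>) \<Longrightarrow> ?th2 x"
    "\<And>s x. \<lbrakk>s \<in> cells \<sigma>; x \<in> topspace (disc (cell_dim \<sigma> s))\<rbrakk> \<Longrightarrow> ?th3 s x"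
    by blast+
qed

lemma body_map_eqI:
  assumes hom: "\<phi> \<in> stratum_hom \<sigma> \<tau>" and h: "h \<in> cmap (body \<S> \<sigma>) W"
    "\<And>x. x \<in> topspace (boundary \<sigma>) \<Longrightarrow> h (body_incl \<S> \<sigma> x) = body_incl \<S> \<tau> (fst \<phi> x)"
    "\<And>s x. \<lbrakk>s \<in> cells \<sigma>; x \<in> topspace (disc (cell_dim \<sigma> s))\<rbrakk> \<Longrightarrow> h (body_char \<S> \<sigma> (s, x)) = body_char \<S> \<tau> (snd \<phi> s, x)"
  shows "body_map \<S> \<sigma> \<tau> \<phi> = h"
  by (rule body_eqI[OF \<sigma> body_map_in[OF hom] h(1)]) (simp_all add: body_map_incl[OF hom] body_map_char[OF hom] h)

text \<open>Morphisms of strata reflect factorisation through the boundary, because they send open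
  cells to open cells: a point whose image lies in the boundary lies itself in the boundary. As
  the boundary is a subspace of the body, a map into the body with image in the boundary factors
  through it. This is why properness is compatible with the morphisms constructed below.\<close>

lemma factors_if_body_map_factors:
  assumes hom: "\<phi> \<in> stratum_hom \<sigma> \<tau>" and b: "b \<in> cmap D (body \<S> \<sigma>)" and c: "c \<in> cmap D (boundary \<tau>)"
    and eq: "\<And>x. x \<in> topspace D \<Longrightarrow> body_map \<S> \<sigma> \<tau> \<phi> (b x) = body_incl \<S> \<tau> (c x)"
  shows "\<exists>c'\<in>cmap D (boundary \<sigma>). b = compose (topspace D) (body_incl \<S> \<sigma>) c'"
proof (rule factors_through_body_incl[OF \<sigma> b])
  fix x assume x: "x \<in> topspace D"
  note hom' = hom[unfolded stratum_hom_pointwise[OF \<tau>]]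
  show "b x \<in> body_incl \<S> \<sigma> ` topspace (boundary \<sigma>)"
  proof (cases rule: body_cases[OF \<sigma> cmap_in[OF b x], case_names boundary interior])
    case (interior s y)
    then have "body_char \<S> \<tau> (snd \<phi> s, y) = body_incl \<S> \<tau> (c x)"
      using eq[OF x] body_map_char[OF hom, of s y] by simp
    moreover have "body_char \<S> \<tau> (snd \<phi> s, y) \<noteq> body_incl \<S> \<tau> (c x)"
      using interior hom' cmap_in[OF c x] by (intro body_char_interior[OF \<tau>]) auto
    ultimately show ?thesis by blast
  qed simp
qed

end

end


section \<open>Arrow categories, and the category of spaces\<close>

lemma compose_restrict_id_right: "f \<in> extensional A \<Longrightarrow> compose A f (restrict id A) = f"
  unfolding compose_def by (auto simp: fun_eq_iff extensional_def)

lemma compose_restrict_id_left: "\<lbrakk>f \<in> extensional A; f \<in> A \<rightarrow> B\<rbrakk> \<Longrightarrow> compose A (restrict id B) f = f"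
  unfolding compose_def by (auto simp: fun_eq_iff extensional_def)

lemma compose_assoc_on: "f \<in> A \<rightarrow> B \<Longrightarrow> compose A h (compose A g f) = compose A (compose B h g) f"
  unfolding compose_def by (auto simp: fun_eq_iff Pi_iff)

lemma cmap_compose_id_right: "f \<in> cmap X Y \<Longrightarrow> compose (topspace X) f (restrict id (topspace X)) = f"
  and cmap_compose_id_left: "f \<in> cmap X Y \<Longrightarrow> compose (topspace X) (restrict id (topspace Y)) f = f"
  and cmap_compose_assoc: "f \<in> cmap X Y \<Longrightarrow>
     compose (topspace X) h (compose (topspace X) g f) = compose (topspace X) (compose (topspace Y) h g) f"
  unfolding cmap_def continuous_map_def
  by (auto intro: compose_restrict_id_right compose_restrict_id_left compose_assoc_on)

lemma is_category_Top: "is_category (Top \<S>)"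
  unfolding is_category_def Top_def
  by (auto simp: id_in_cmap cmap_compose_id_right cmap_compose_id_left cmap_compose_assoc
      intro: compose_in_cmap)

lemma is_category_arrow_category:
  assumes C: "is_category C"
  shows "is_category (arrow_category C)"
proof -
  have "Comp C A A'' B'' f'' (Comp C A A' A'' u' u) = Comp C A B B'' (Comp C B B' B'' v' v) f"
    if "A \<in> Obj C" "B \<in> Obj C" "f \<in> Hom C A B" "A' \<in> Obj C" "B' \<in> Obj C" "f' \<in> Hom C A' B'"
      "A'' \<in> Obj C" "B'' \<in> Obj C" "f'' \<in> Hom C A'' B''"
      "u \<in> Hom C A A'" "v \<in> Hom C B B'" "Comp C A A' B' f' u = Comp C A B B' v f"
      "u' \<in> Hom C A' A''" "v' \<in> Hom C B' B''" "Comp C A' A'' B'' f'' u' = Comp C A' B' B'' v' f'"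
    for A B f A' B' f' A'' B'' f'' u v u' v'
  proof -
    have "Comp C A A'' B'' f'' (Comp C A A' A'' u' u) = Comp C A A' B'' (Comp C A' B' B'' v' f') u"
      using that by (simp add: category_assoc[OF C])
    also have "\<dots> = Comp C A B' B'' v' (Comp C A A' B' f' u)"
      by (rule category_assoc[OF C, symmetric]) (use that in auto)
    also have "\<dots> = Comp C A B B'' (Comp C B B' B'' v' v) f"
      using that by (simp add: category_assoc[OF C])
    finally show ?thesis .
  qed
  note paste = this
  show ?thesis
    unfolding is_category_def
  proof (intro conjI ballI)
    fix X assume "X \<in> Obj (arrow_category C)"
    then show "Id (arrow_category C) X \<in> Hom (arrow_category C) X X"
      by (cases X)
        (simp add: arrow_category_def category_Id_left[OF C] category_Id_right[OF C] category_Id[OF C])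
  next
    fix X X' X'' g g'
    assume *: "X \<in> Obj (arrow_category C)" "X' \<in> Obj (arrow_category C)" "X'' \<in> Obj (arrow_category C)"
      "g \<in> Hom (arrow_category C) X X'" "g' \<in> Hom (arrow_category C) X' X''"
    obtain A B f A' B' f' A'' B'' f'' where X: "X = (A, B, f)" "X' = (A', B', f')" "X'' = (A'', B'', f'')"
      by (cases X; cases X'; cases X'')
    obtain u v u' v' where g: "g = (u, v)" "g' = (u', v')"
      by (cases g; cases g')
    show "Comp (arrow_category C) X X' X'' g' g \<in> Hom (arrow_category C) X X''"
      using * paste[of A B f A' B' f' A'' B'' f'' u v u' v']
      unfolding X g by (simp add: arrow_category_def category_Comp[OF C])
  next
    fix X Y f
    assume "X \<in> Obj (arrow_category C)" "Y \<in> Obj (arrow_category C)" "f \<in> Hom (arrow_category C) X Y"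
    then show "Comp (arrow_category C) X X Y f (Id (arrow_category C) X) = f"
      "Comp (arrow_category C) X Y Y (Id (arrow_category C) Y) f = f"
      by (cases X; cases Y; cases f;
          simp add: arrow_category_def category_Id_left[OF C] category_Id_right[OF C])+
  next
    fix W X Y Z f g h
    assume "W \<in> Obj (arrow_category C)" "X \<in> Obj (arrow_category C)" "Y \<in> Obj (arrow_category C)"
      "Z \<in> Obj (arrow_category C)" "f \<in> Hom (arrow_category C) W X"
      "g \<in> Hom (arrow_category C) X Y" "h \<in> Hom (arrow_category C) Y Z"
    then show "Comp (arrow_category C) W Y Z h (Comp (arrow_category C) W X Y g f) =
        Comp (arrow_category C) W X Z (Comp (arrow_category C) X Y Z h g) f"
      by (cases W; cases X; cases Y; cases Z; cases f; cases g; cases h)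
        (clarsimp simp: arrow_category_def, intro conjI; rule category_assoc[OF C]; assumption)
  qed
qed

context small_universe begin

section \<open>The category of relative cell complexes\<close>

lemma stratum_hom_id:
  assumes "is_stratum \<S> \<sigma>"
  shows "(restrict id (topspace (boundary \<sigma>)), restrict id (cells \<sigma>)) \<in> stratum_hom \<sigma> \<sigma>"
    and "body_map \<S> \<sigma> \<sigma> (restrict id (topspace (boundary \<sigma>)), restrict id (cells \<sigma>)) =
      restrict id (topspace (body \<S> \<sigma>))"
proof -
  show *: "(restrict id (topspace (boundary \<sigma>)), restrict id (cells \<sigma>)) \<in> stratum_hom \<sigma> \<sigma>"
    using assms by (auto simp: stratum_hom_pointwise id_in_cmap attach_in)
  have "(s, x) \<in> topspace (cell_discs \<sigma>)" if "s \<in> cells \<sigma>" "x \<in> topspace (disc (cell_dim \<sigma> s))" for s x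
    using that by (simp add: topspace_cell_discs)
  then show "body_map \<S> \<sigma> \<sigma> (restrict id (topspace (boundary \<sigma>)), restrict id (cells \<sigma>)) =
      restrict id (topspace (body \<S> \<sigma>))"
    using cmap_in[OF body_incl[OF assms]] cmap_in[OF body_char[OF assms]]
    by (intro body_map_eqI[OF assms assms * id_in_cmap]) auto
qed

lemma stratum_hom_comp:
  assumes \<rho>: "is_stratum \<S> \<rho>" and \<sigma>: "is_stratum \<S> \<sigma>" and \<tau>: "is_stratum \<S> \<tau>"
    and \<phi>: "\<phi> \<in> stratum_hom \<rho> \<sigma>" and \<psi>: "\<psi> \<in> stratum_hom \<sigma> \<tau>"
  defines "\<omega> \<equiv> (compose (topspace (boundary \<rho>)) (fst \<psi>) (fst \<phi>), compose (cells \<rho>) (snd \<psi>) (snd \<phi>))"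
  shows "\<omega> \<in> stratum_hom \<rho> \<tau>"
    and "body_map \<S> \<rho> \<tau> \<omega> =
      compose (topspace (body \<S> \<rho>)) (body_map \<S> \<sigma> \<tau> \<psi>) (body_map \<S> \<rho> \<sigma> \<phi>)"
proof -
  note \<phi>' = \<phi>[unfolded stratum_hom_pointwise[OF \<sigma>]]
  note \<psi>' = \<psi>[unfolded stratum_hom_pointwise[OF \<tau>]]
  have fst: "fst \<phi> x \<in> topspace (boundary \<sigma>)" if "x \<in> topspace (boundary \<rho>)" for x
    by (rule cmap_in[OF conjunct1[OF \<phi>'] that])
  have snd: "snd \<phi> s \<in> cells \<sigma>" "cell_dim \<sigma> (snd \<phi> s) = cell_dim \<rho> s" if "s \<in> cells \<rho>" for s
    using \<phi>' that by auto
  show \<omega>: "\<omega> \<in> stratum_hom \<rho> \<tau>"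
    unfolding stratum_hom_pointwise[OF \<tau>]
  proof (intro conjI ballI)
    show "fst \<omega> \<in> cmap (boundary \<rho>) (boundary \<tau>)" "snd \<omega> \<in> cells \<rho> \<rightarrow>\<^sub>E cells \<tau>"
      using \<phi>' \<psi>' by (auto simp: \<omega>_def compose_def intro: compose_in_cmap[unfolded compose_def])
    fix s assume s: "s \<in> cells \<rho>"
    then show "cell_dim \<rho> s = cell_dim \<tau> (snd \<omega> s)"
      using \<phi>' \<psi>' snd[OF s] by (simp add: \<omega>_def compose_eq)
    fix x assume x: "x \<in> topspace (disc_boundary (cell_dim \<rho> s))"
    then have "fst \<phi> (attach \<rho> s x) = attach \<sigma> (snd \<phi> s) x"
      using \<phi>' s by blast
    moreover have "fst \<psi> (attach \<sigma> (snd \<phi> s) x) = attach \<tau> (snd \<psi> (snd \<phi> s)) x"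
      using \<psi>' snd[OF s] x by auto
    ultimately show "fst \<omega> (attach \<rho> s x) = attach \<tau> (snd \<omega> s) x"
      using attach_in[OF \<rho> s x] s by (simp add: \<omega>_def compose_eq)
  qed
  have "body_incl \<S> \<rho> x \<in> topspace (body \<S> \<rho>)" if "x \<in> topspace (boundary \<rho>)" for x
    using cmap_in[OF body_incl[OF \<rho>] that] .
  moreover have "body_char \<S> \<rho> (s, x) \<in> topspace (body \<S> \<rho>)"
    if "s \<in> cells \<rho>" "x \<in> topspace (disc (cell_dim \<rho> s))" for s x
    using cmap_in[OF body_char[OF \<rho>]] that by (simp add: topspace_cell_discs)
  ultimately show "body_map \<S> \<rho> \<tau> \<omega> =
      compose (topspace (body \<S> \<rho>)) (body_map \<S> \<sigma> \<tau> \<psi>) (body_map \<S> \<rho> \<sigma> \<phi>)"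
    using fst snd
    by (intro body_map_eqI[OF \<rho> \<tau> \<omega> compose_in_cmap[OF body_map_in[OF \<rho> \<sigma> \<phi>] body_map_in[OF \<sigma> \<tau> \<psi>]]])
      (simp_all add: \<omega>_def compose_eq body_map_incl[OF \<rho> \<sigma> \<phi>] body_map_incl[OF \<sigma> \<tau> \<psi>]
        body_map_char[OF \<rho> \<sigma> \<phi>] body_map_char[OF \<sigma> \<tau> \<psi>])
qed

lemma cell_complex_stratum: "is_cell_complex \<S> K \<Longrightarrow> is_stratum \<S> (K n)"
  and cell_complex_boundary_Suc: "is_cell_complex \<S> K \<Longrightarrow> boundary (K (Suc n)) = body \<S> (K n)"
  unfolding is_cell_complex_def connected_strata_def by blast+

lemma cell_complex_hom_stratum: "\<phi> \<in> cell_complex_hom \<S> K L \<Longrightarrow> \<phi> n \<in> stratum_hom (K n) (L n)"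
  and cell_complex_hom_Suc:
    "\<phi> \<in> cell_complex_hom \<S> K L \<Longrightarrow> fst (\<phi> (Suc n)) = body_map \<S> (K n) (L n) (\<phi> n)"
  unfolding cell_complex_hom_def by blast+

lemma cell_complex_hom_fst: "\<phi> \<in> cell_complex_hom \<S> K L \<Longrightarrow> fst (\<phi> n) \<in> cmap (boundary (K n)) (boundary (L n))"
  and cell_complex_hom_snd: "\<phi> \<in> cell_complex_hom \<S> K L \<Longrightarrow> snd (\<phi> n) \<in> cells (K n) \<rightarrow>\<^sub>E cells (L n)"
  by (drule cell_complex_hom_stratum[of _ _ _ n], simp add: stratum_hom_def case_prod_beta)+

lemma is_category_CellCx: "is_category (CellCx \<S>)"
  unfolding is_category_def CellCx_def category.simps mem_Collect_eq
proof (intro conjI ballI, unfold mem_Collect_eq)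
  fix K assume K: "is_cell_complex \<S> K"
  show "(\<lambda>n. (restrict id (topspace (boundary (K n))), restrict id (cells (K n)))) \<in> cell_complex_hom \<S> K K"
    using stratum_hom_id[OF cell_complex_stratum[OF K]] cell_complex_boundary_Suc[OF K]
    by (simp add: cell_complex_hom_def)
next
  fix K L M \<phi> \<psi>
  assume "is_cell_complex \<S> K" "is_cell_complex \<S> L" "is_cell_complex \<S> M"
    and \<phi>: "\<phi> \<in> cell_complex_hom \<S> K L" and \<psi>: "\<psi> \<in> cell_complex_hom \<S> L M"
  then have K: "\<And>n. is_stratum \<S> (K n)" "\<And>n. boundary (K (Suc n)) = body \<S> (K n)"
    and L: "\<And>n. is_stratum \<S> (L n)" and M: "\<And>n. is_stratum \<S> (M n)"
    by (simp_all add: cell_complex_stratum cell_complex_boundary_Suc)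
  note * = stratum_hom_comp[OF K(1) L M cell_complex_hom_stratum[OF \<phi>] cell_complex_hom_stratum[OF \<psi>]]
  show "(\<lambda>n. (compose (topspace (boundary (K n))) (fst (\<psi> n)) (fst (\<phi> n)),
      compose (cells (K n)) (snd (\<psi> n)) (snd (\<phi> n)))) \<in> cell_complex_hom \<S> K M"
    using * by (simp add: cell_complex_hom_def K(2) cell_complex_hom_Suc[OF \<phi>] cell_complex_hom_Suc[OF \<psi>])
next
  fix K L \<phi> assume \<phi>: "\<phi> \<in> cell_complex_hom \<S> K L"
  note f = cell_complex_hom_fst[OF \<phi>] and p = cell_complex_hom_snd[OF \<phi>]
  show "(\<lambda>n. (compose (topspace (boundary (K n))) (fst (\<phi> n)) (fst (restrict id (topspace (boundary (K n))), restrict id (cells (K n)))),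
      compose (cells (K n)) (snd (\<phi> n)) (snd (restrict id (topspace (boundary (K n))), restrict id (cells (K n)))))) = \<phi>"
    using p by (simp add: cmap_compose_id_right[OF f] compose_restrict_id_right PiE_iff)
  show "(\<lambda>n. (compose (topspace (boundary (K n))) (fst (restrict id (topspace (boundary (L n))), restrict id (cells (L n)))) (fst (\<phi> n)),
      compose (cells (K n)) (snd (restrict id (topspace (boundary (L n))), restrict id (cells (L n)))) (snd (\<phi> n)))) = \<phi>"
    using p by (simp add: cmap_compose_id_left[OF f] compose_restrict_id_left[of _ "cells (K _)" "cells (L _)"] PiE_def)
next
  fix J K L M \<phi> \<psi> \<omega>
  assume \<phi>: "\<phi> \<in> cell_complex_hom \<S> J K"
  have "snd (\<phi> n) \<in> cells (J n) \<rightarrow> cells (K n)" for n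
    using cell_complex_hom_snd[OF \<phi>, of n] by (simp add: PiE_def)
  note snd_assoc = compose_assoc_on[OF this]
  show "(\<lambda>n. (compose (topspace (boundary (J n))) (fst (\<omega> n))
       (fst (compose (topspace (boundary (J n))) (fst (\<psi> n)) (fst (\<phi> n)), compose (cells (J n)) (snd (\<psi> n)) (snd (\<phi> n)))),
      compose (cells (J n)) (snd (\<omega> n))
       (snd (compose (topspace (boundary (J n))) (fst (\<psi> n)) (fst (\<phi> n)), compose (cells (J n)) (snd (\<psi> n)) (snd (\<phi> n)))))) =
     (\<lambda>n. (compose (topspace (boundary (J n)))
       (fst (compose (topspace (boundary (K n))) (fst (\<omega> n)) (fst (\<psi> n)), compose (cells (K n)) (snd (\<omega> n)) (snd (\<psi> n))))
       (fst (\<phi> n)),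
      compose (cells (J n))
       (snd (compose (topspace (boundary (K n))) (fst (\<omega> n)) (fst (\<psi> n)), compose (cells (K n)) (snd (\<omega> n)) (snd (\<psi> n))))
       (snd (\<phi> n))))"
    by (simp add: cmap_compose_assoc[OF cell_complex_hom_fst[OF \<phi>]] snd_assoc)
qed


section \<open>The body of a cell complex, and the functor\<close>

context
  fixes K
  assumes K: "is_cell_complex \<S> K"
begin

lemma body_incl_step: "body_incl \<S> (K n) \<in> cmap (boundary (K n)) (boundary (K (Suc n)))"
  by (simp add: cell_complex_boundary_Suc[OF K] body_incl[OF cell_complex_stratum[OF K]])

lemma complex_colimit:
  "is_seq_colimit \<S> (\<lambda>n. boundary (K n)) (\<lambda>n. body_incl \<S> (K n)) (complex_body \<S> K, complex_incl \<S> K)"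
proof -
  have "\<exists>P. is_seq_colimit \<S> (\<lambda>n. boundary (K n)) (\<lambda>n. body_incl \<S> (K n)) P"
    using cell_complex_stratum[OF K] by (intro seq_colimit_exists body_incl_step) (simp add: is_stratum_def)
  then show ?thesis
    unfolding complex_body_def complex_incl_def complex_cocone_def prod.collapse by (rule someI_ex)
qed

lemma complex_body_space: "is_space \<S> (complex_body \<S> K)"
  and complex_incl: "complex_incl \<S> K n \<in> cmap (boundary (K n)) (complex_body \<S> K)"
  and complex_incl_Suc: "x \<in> topspace (boundary (K n)) \<Longrightarrow>
    complex_incl \<S> K (Suc n) (body_incl \<S> (K n) x) = complex_incl \<S> K n x"
  using complex_colimit unfolding is_seq_colimit_pointwise by simp_all

lemma complex_body_universal:
  assumes "is_space \<S> W" "\<And>n. u n \<in> cmap (boundary (K n)) W"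
    "\<And>n x. x \<in> topspace (boundary (K n)) \<Longrightarrow> u (Suc n) (body_incl \<S> (K n) x) = u n x"
  shows "\<exists>!h. h \<in> cmap (complex_body \<S> K) W \<and>
    (\<forall>n. \<forall>x\<in>topspace (boundary (K n)). h (complex_incl \<S> K n x) = u n x)"
  by (rule complex_colimit[unfolded is_seq_colimit_pointwise, THEN conjunct2, THEN conjunct2,
        THEN conjunct2, THEN spec, THEN spec, THEN mp]) (simp add: assms)

lemma complex_body_eqI:
  assumes W: "is_space \<S> W" and h: "h \<in> cmap (complex_body \<S> K) W" and h': "h' \<in> cmap (complex_body \<S> K) W"
    and eq: "\<And>n x. x \<in> topspace (boundary (K n)) \<Longrightarrow> h (complex_incl \<S> K n x) = h' (complex_incl \<S> K n x)"
  shows "h = h'"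
proof -
  define u where "u n = compose (topspace (boundary (K n))) h (complex_incl \<S> K n)" for n
  have "\<exists>!g. g \<in> cmap (complex_body \<S> K) W \<and>
      (\<forall>n. \<forall>x\<in>topspace (boundary (K n)). g (complex_incl \<S> K n x) = u n x)"
  proof (rule complex_body_universal[OF W])
    show "u n \<in> cmap (boundary (K n)) W" for n
      unfolding u_def by (rule compose_in_cmap[OF complex_incl h])
    show "u (Suc n) (body_incl \<S> (K n) x) = u n x" if "x \<in> topspace (boundary (K n))" for n x
      using that cmap_in[OF body_incl_step that] by (simp add: u_def compose_eq complex_incl_Suc)
  qed
  moreover have "\<forall>n. \<forall>x\<in>topspace (boundary (K n)). h (complex_incl \<S> K n x) = u n x"
    by (simp add: u_def compose_eq)
  moreover from this have "\<forall>n. \<forall>x\<in>topspace (boundary (K n)). h' (complex_incl \<S> K n x) = u n x"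
    using eq by simp
  ultimately show ?thesis using h h' by (elim ex1E) metis
qed

end

context
  fixes K L \<phi>
  assumes K: "is_cell_complex \<S> K" and L: "is_cell_complex \<S> L" and \<phi>: "\<phi> \<in> cell_complex_hom \<S> K L"
begin

lemma complex_body_map:
  shows complex_body_map_in: "complex_body_map \<S> K L \<phi> \<in> cmap (complex_body \<S> K) (complex_body \<S> L)"
    and complex_body_map_incl: "x \<in> topspace (boundary (K n)) \<Longrightarrow>
      complex_body_map \<S> K L \<phi> (complex_incl \<S> K n x) = complex_incl \<S> L n (fst (\<phi> n) x)"
proof -
  define u where "u n = compose (topspace (boundary (K n))) (complex_incl \<S> L n) (fst (\<phi> n))" for n
  let ?P = "\<lambda>h. h \<in> cmap (complex_body \<S> K) (complex_body \<S> L) \<and>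
      (\<forall>n. \<forall>x\<in>topspace (boundary (K n)). h (complex_incl \<S> K n x) = u n x)"
  have "\<exists>!h. ?P h"
  proof (rule complex_body_universal[OF K complex_body_space[OF L]])
    show "u n \<in> cmap (boundary (K n)) (complex_body \<S> L)" for n
      unfolding u_def by (rule compose_in_cmap[OF cell_complex_hom_fst[OF \<phi>] complex_incl[OF L]])
    show "u (Suc n) (body_incl \<S> (K n) x) = u n x" if x: "x \<in> topspace (boundary (K n))" for n x
      using x cmap_in[OF body_incl_step[OF K] x] cmap_in[OF cell_complex_hom_fst[OF \<phi>] x]
      by (simp add: u_def compose_eq cell_complex_hom_Suc[OF \<phi>] complex_incl_Suc[OF L]
          body_map_incl[OF cell_complex_stratum[OF K] cell_complex_stratum[OF L] cell_complex_hom_stratum[OF \<phi>]])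
  qed
  then have "?P (THE h. ?P h)" by (rule theI')
  moreover have "complex_body_map \<S> K L \<phi> = (THE h. ?P h)"
    unfolding complex_body_map_def compose_eq_iff by (simp add: u_def compose_eq cong: conj_cong)
  ultimately have "?P (complex_body_map \<S> K L \<phi>)" by simp
  then show "complex_body_map \<S> K L \<phi> \<in> cmap (complex_body \<S> K) (complex_body \<S> L)"
    "x \<in> topspace (boundary (K n)) \<Longrightarrow>
      complex_body_map \<S> K L \<phi> (complex_incl \<S> K n x) = complex_incl \<S> L n (fst (\<phi> n) x)"
    by (simp_all add: u_def compose_eq)
qed

end

lemma CellCx_simps:
  "Obj (CellCx \<S>) = {K. is_cell_complex \<S> K}" "Hom (CellCx \<S>) = cell_complex_hom \<S>"
  "Id (CellCx \<S>) K n = (restrict id (topspace (boundary (K n))), restrict id (cells (K n)))"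
  "Comp (CellCx \<S>) K L M \<psi> \<phi> n = (compose (topspace (boundary (K n))) (fst (\<psi> n)) (fst (\<phi> n)),
                  compose (cells (K n)) (snd (\<psi> n)) (snd (\<phi> n)))"
  by (simp_all add: CellCx_def)

lemma is_functor_U_CellCx: "is_functor (CellCx \<S>) (arrow_category (Top \<S>)) (U_CellCx \<S>)"
  unfolding is_functor_def
proof (intro conjI ballI is_category_CellCx is_category_arrow_category is_category_Top)
  fix K assume "K \<in> Obj (CellCx \<S>)"
  then have K: "is_cell_complex \<S> K" by (simp add: CellCx_simps)
  show "ObjMap (U_CellCx \<S>) K \<in> Obj (arrow_category (Top \<S>))"
    using cell_complex_stratum[OF K] complex_body_space[OF K] complex_incl[OF K]
    by (simp add: U_CellCx_def arrow_category_def Top_def is_stratum_def)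
  have id: "Id (CellCx \<S>) K \<in> cell_complex_hom \<S> K K"
    using category_Id[OF is_category_CellCx, of K] K by (simp add: CellCx_simps)
  have "complex_body_map \<S> K K (Id (CellCx \<S>) K) = restrict id (topspace (complex_body \<S> K))"
    by (rule complex_body_eqI[OF K complex_body_space[OF K] complex_body_map_in[OF K K id] id_in_cmap])
      (simp add: complex_body_map_incl[OF K K id] cmap_in[OF complex_incl[OF K]] CellCx_simps)
  then show "ArrMap (U_CellCx \<S>) K K (Id (CellCx \<S>) K) = Id (arrow_category (Top \<S>)) (ObjMap (U_CellCx \<S>) K)"
    by (simp add: U_CellCx_def arrow_category_def Top_def CellCx_simps)
next
  fix K L \<phi> assume "K \<in> Obj (CellCx \<S>)" "L \<in> Obj (CellCx \<S>)" "\<phi> \<in> Hom (CellCx \<S>) K L"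
  then have *: "is_cell_complex \<S> K" "is_cell_complex \<S> L" "\<phi> \<in> cell_complex_hom \<S> K L"
    by (simp_all add: CellCx_simps)
  show "ArrMap (U_CellCx \<S>) K L \<phi> \<in> Hom (arrow_category (Top \<S>)) (ObjMap (U_CellCx \<S>) K) (ObjMap (U_CellCx \<S>) L)"
    using complex_body_map_in[OF *] complex_body_map_incl[OF *] cell_complex_hom_fst[OF *(3)]
    by (simp add: U_CellCx_def arrow_category_def Top_def compose_eq_iff)
next
  fix K L M \<phi> \<psi>
  assume "K \<in> Obj (CellCx \<S>)" "L \<in> Obj (CellCx \<S>)" "M \<in> Obj (CellCx \<S>)"
    "\<phi> \<in> Hom (CellCx \<S>) K L" "\<psi> \<in> Hom (CellCx \<S>) L M"
  then have K: "is_cell_complex \<S> K" and L: "is_cell_complex \<S> L" and M: "is_cell_complex \<S> M"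
    and \<phi>: "\<phi> \<in> cell_complex_hom \<S> K L" and \<psi>: "\<psi> \<in> cell_complex_hom \<S> L M"
    and \<psi>\<phi>: "Comp (CellCx \<S>) K L M \<psi> \<phi> \<in> cell_complex_hom \<S> K M"
    using category_Comp[OF is_category_CellCx, of K L M \<phi> \<psi>] by (simp_all add: CellCx_simps(1,2))
  have "complex_body_map \<S> K M (Comp (CellCx \<S>) K L M \<psi> \<phi>) =
      compose (topspace (complex_body \<S> K)) (complex_body_map \<S> L M \<psi>) (complex_body_map \<S> K L \<phi>)"
    by (rule complex_body_eqI[OF K complex_body_space[OF M] complex_body_map_in[OF K M \<psi>\<phi>]
          compose_in_cmap[OF complex_body_map_in[OF K L \<phi>] complex_body_map_in[OF L M \<psi>]]])
      (simp add: complex_body_map_incl[OF K M \<psi>\<phi>] complex_body_map_incl[OF K L \<phi>] complex_body_map_incl[OF L M \<psi>]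
        compose_eq CellCx_simps cmap_in[OF complex_incl[OF K]] cmap_in[OF cell_complex_hom_fst[OF \<phi>]])
  then show "ArrMap (U_CellCx \<S>) K M (Comp (CellCx \<S>) K L M \<psi> \<phi>) =
      Comp (arrow_category (Top \<S>)) (ObjMap (U_CellCx \<S>) K) (ObjMap (U_CellCx \<S>) L) (ObjMap (U_CellCx \<S>) M)
        (ArrMap (U_CellCx \<S>) L M \<psi>) (ArrMap (U_CellCx \<S>) K L \<phi>)"
    by (simp add: U_CellCx_def arrow_category_def Top_def CellCx_simps)
qed

end

context small_universe begin

section \<open>Strata classifying squares\<close>

text \<open>The commutative squares from a sphere inclusion to \<open>g\<close>, where the predicate \<open>N\<close> restricts
  the upper map \<open>b\<close>; later it excludes the maps that factor through the previous stage of a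
  complex.\<close>

definition squares :: "'u topology \<Rightarrow> 'u topology \<Rightarrow> ('u \<Rightarrow> 'u) \<Rightarrow> (nat \<Rightarrow> ((nat \<Rightarrow> real) \<Rightarrow> 'u) \<Rightarrow> bool) \<Rightarrow>
    (nat \<times> ((nat \<Rightarrow> real) \<Rightarrow> 'u) \<times> ((nat \<Rightarrow> real) \<Rightarrow> 'u)) set" where
  "squares X B g N = {(d, b, c). b \<in> cmap (disc_boundary d) X \<and> c \<in> cmap (disc d) B \<and>
     (\<forall>x\<in>topspace (disc_boundary d). g (b x) = c x) \<and> N d b}"

definition cell_square :: "'u stratum \<Rightarrow> ('u \<Rightarrow> 'u) \<Rightarrow> 'u \<Rightarrow> nat \<times> ((nat \<Rightarrow> real) \<Rightarrow> 'u) \<times> ((nat \<Rightarrow> real) \<Rightarrow> 'u)" where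
  "cell_square \<sigma> g' s = (cell_dim \<sigma> s, attach \<sigma> s,
     \<lambda>x\<in>topspace (disc (cell_dim \<sigma> s)). g' (body_char \<S> \<sigma> (s, x)))"

text \<open>Each cell lies over the square formed by its attaching map and the composite of \<open>g'\<close> with
  its characteristic map, and every admissible square over \<open>g\<close> arises from exactly one cell. The
  extension \<open>g'\<close> is the map over which the next stage of the construction is built.\<close>

definition classifying :: "'u topology \<Rightarrow> (nat \<Rightarrow> ((nat \<Rightarrow> real) \<Rightarrow> 'u) \<Rightarrow> bool) \<Rightarrow> 'u stratum \<Rightarrow>
    ('u \<Rightarrow> 'u) \<Rightarrow> ('u \<Rightarrow> 'u) \<Rightarrow> bool" where
  "classifying B N \<sigma> g g' \<longleftrightarrow> is_stratum \<S> \<sigma> \<and> g' \<in> cmap (body \<S> \<sigma>) B \<and>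
     (\<forall>x\<in>topspace (boundary \<sigma>). g' (body_incl \<S> \<sigma> x) = g x) \<and>
     bij_betw (cell_square \<sigma> g') (cells \<sigma>) (squares (boundary \<sigma>) B g N)"

lemma small_squares:
  assumes "is_space \<S> X" "is_space \<S> B"
  shows "small \<S> (squares X B g N)"
proof -
  have "small \<S> (SIGMA d:UNIV. (topspace (disc_boundary d) \<rightarrow>\<^sub>E topspace X) \<times> (topspace (disc d) \<rightarrow>\<^sub>E topspace B))"
    using assms by (intro small_Sigma_nat small_Times small_extensional_functions)
      (simp_all add: is_space_def small_subset_iff)
  then show ?thesis
    by (rule small_subset) (auto simp: squares_def PiE_def cmap_def continuous_map_def)
qed

text \<open>One cell for each admissible square. As the cells have to be elements of \<open>'u\<close>, squares are
  renamed by an injection \<open>e\<close>, which exists because the set of squares is small.\<close>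

lemma classifying_stratum_exists:
  assumes X: "is_space \<S> X" and B: "is_space \<S> B" and g: "g \<in> cmap X B"
  shows "\<exists>\<sigma> g'. boundary \<sigma> = X \<and> classifying B N \<sigma> g g'"
proof -
  define T where "T = squares X B g N"
  obtain e :: "_ \<Rightarrow> 'u" where e: "inj_on e T" "e ` T \<in> \<S>"
    using small_encode[OF small_squares[OF X B]] unfolding T_def by blast
  define r where "r = inv_into T e"
  have r: "bij_betw r (e ` T) T"
    unfolding r_def by (intro bij_betw_inv_into inj_on_imp_bij_betw e)
  define \<sigma> where "\<sigma> = \<lparr> boundary = X, cells = e ` T,
      cell_dim = (\<lambda>s\<in>e ` T. fst (r s)), attach = (\<lambda>s\<in>e ` T. fst (snd (r s))) \<rparr>"
  have sq: "attach \<sigma> s \<in> cmap (disc_boundary (cell_dim \<sigma> s)) X"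
    "snd (snd (r s)) \<in> cmap (disc (cell_dim \<sigma> s)) B"
    "x \<in> topspace (disc_boundary (cell_dim \<sigma> s)) \<Longrightarrow> g (attach \<sigma> s x) = snd (snd (r s)) x"
    if "s \<in> cells \<sigma>" for s x
  proof -
    have "s \<in> e ` T" using that by (simp add: \<sigma>_def)
    then have "r s \<in> T" by (rule bij_betw_apply[OF r])
    then show "attach \<sigma> s \<in> cmap (disc_boundary (cell_dim \<sigma> s)) X"
      "snd (snd (r s)) \<in> cmap (disc (cell_dim \<sigma> s)) B"
      "x \<in> topspace (disc_boundary (cell_dim \<sigma> s)) \<Longrightarrow> g (attach \<sigma> s x) = snd (snd (r s)) x"
      using that by (auto simp: T_def squares_def \<sigma>_def)
  qed
  have \<sigma>: "is_stratum \<S> \<sigma>"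
    unfolding is_stratum_def using sq(1) X e(2) by (simp add: \<sigma>_def)
  have "\<exists>!h. h \<in> cmap (body \<S> \<sigma>) B \<and> (\<forall>x\<in>topspace (boundary \<sigma>). h (body_incl \<S> \<sigma> x) = g x) \<and>
    (\<forall>s\<in>cells \<sigma>. \<forall>x\<in>topspace (disc (cell_dim \<sigma> s)). h (body_char \<S> \<sigma> (s, x)) = snd (snd (r s)) x)"
    using sq g by (intro body_universal[OF \<sigma> B]) (auto simp: \<sigma>_def intro: cmap_imp_continuous_map)
  then obtain g' where g': "g' \<in> cmap (body \<S> \<sigma>) B" "\<forall>x\<in>topspace (boundary \<sigma>). g' (body_incl \<S> \<sigma> x) = g x"
    "\<forall>s\<in>cells \<sigma>. \<forall>x\<in>topspace (disc (cell_dim \<sigma> s)). g' (body_char \<S> \<sigma> (s, x)) = snd (snd (r s)) x"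
    by blast
  have "cell_square \<sigma> g' s = r s" if s: "s \<in> cells \<sigma>" for s
  proof -
    have "(\<lambda>x\<in>topspace (disc (cell_dim \<sigma> s)). g' (body_char \<S> \<sigma> (s, x))) = snd (snd (r s))"
      using g'(3) s sq(2)[OF s] by (intro extensionalityI[of _ "topspace (disc (cell_dim \<sigma> s))"]) (auto simp: cmap_def)
    then show ?thesis
      using s by (simp add: cell_square_def \<sigma>_def)
  qed
  then have "bij_betw (cell_square \<sigma> g') (cells \<sigma>) T"
    using r by (subst bij_betw_cong[of _ _ r]) (auto simp: \<sigma>_def)
  then have "classifying B N \<sigma> g g'"
    unfolding classifying_def using \<sigma> g' by (simp add: T_def \<sigma>_def)
  then show ?thesis by (intro exI[of _ \<sigma>] exI[of _ g']) (simp add: \<sigma>_def)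
qed

text \<open>The square of the image of a cell depends only on the map on boundaries and on \<open>w\<close>, the
  composite to \<open>B\<close>. In a classifying stratum the square determines the cell; this yields both the
  uniqueness and the existence of morphisms of strata over \<open>B\<close>.\<close>

lemma cell_square_hom:
  assumes \<sigma>: "is_stratum \<S> \<sigma>" and \<tau>: "is_stratum \<S> \<tau>" and \<phi>: "\<phi> \<in> stratum_hom \<sigma> \<tau>"
    and w: "\<And>z. z \<in> topspace (body \<S> \<sigma>) \<Longrightarrow> g' (body_map \<S> \<sigma> \<tau> \<phi> z) = w z" and s: "s \<in> cells \<sigma>"
  shows "cell_square \<tau> g' (snd \<phi> s) =
    (cell_dim \<sigma> s, compose (topspace (disc_boundary (cell_dim \<sigma> s))) (fst \<phi>) (attach \<sigma> s),
     \<lambda>x\<in>topspace (disc (cell_dim \<sigma> s)). w (body_char \<S> \<sigma> (s, x)))"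
proof -
  have "g' (body_char \<S> \<tau> (snd \<phi> s, x)) = w (body_char \<S> \<sigma> (s, x))"
    if "x \<in> topspace (disc (cell_dim \<sigma> s))" for x
  proof -
    have "body_char \<S> \<sigma> (s, x) \<in> topspace (body \<S> \<sigma>)"
      using that s cmap_in[OF body_char[OF \<sigma>]] by (simp add: topspace_cell_discs)
    then show ?thesis
      using w[of "body_char \<S> \<sigma> (s, x)"] by (simp add: body_map_char[OF \<sigma> \<tau> \<phi> s that])
  qed
  moreover have "cell_dim \<tau> (snd \<phi> s) = cell_dim \<sigma> s"
    "attach \<tau> (snd \<phi> s) = compose (topspace (disc_boundary (cell_dim \<sigma> s))) (fst \<phi>) (attach \<sigma> s)"
    using \<phi> s unfolding stratum_hom_def by auto
  ultimately show ?thesis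
    by (simp add: cell_square_def cong: restrict_cong)
qed

lemma classifying_hom_unique:
  assumes \<sigma>: "is_stratum \<S> \<sigma>" and \<tau>: "classifying B N \<tau> g g'"
    and \<phi>: "\<phi> \<in> stratum_hom \<sigma> \<tau>" and \<psi>: "\<psi> \<in> stratum_hom \<sigma> \<tau>" and fst: "fst \<phi> = fst \<psi>"
    and w: "\<And>z. z \<in> topspace (body \<S> \<sigma>) \<Longrightarrow> g' (body_map \<S> \<sigma> \<tau> \<phi> z) = w z"
      "\<And>z. z \<in> topspace (body \<S> \<sigma>) \<Longrightarrow> g' (body_map \<S> \<sigma> \<tau> \<psi> z) = w z"
  shows "\<phi> = \<psi>"
proof -
  have \<tau>': "is_stratum \<S> \<tau>" and inj: "inj_on (cell_square \<tau> g') (cells \<tau>)"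
    using \<tau> by (auto simp: classifying_def bij_betw_def)
  have ext: "snd \<phi> \<in> cells \<sigma> \<rightarrow>\<^sub>E cells \<tau>" "snd \<psi> \<in> cells \<sigma> \<rightarrow>\<^sub>E cells \<tau>"
    using \<phi> \<psi> by (auto simp: stratum_hom_def)
  have "snd \<phi> s = snd \<psi> s" if s: "s \<in> cells \<sigma>" for s
  proof (rule inj_onD[OF inj])
    show "cell_square \<tau> g' (snd \<phi> s) = cell_square \<tau> g' (snd \<psi> s)"
      using cell_square_hom[where w = w, OF \<sigma> \<tau>' \<phi> w(1) s]
        cell_square_hom[where w = w, OF \<sigma> \<tau>' \<psi> w(2) s] fst by simp
  qed (use ext s in auto)
  then have "snd \<phi> = snd \<psi>" using ext by (intro PiE_ext)
  with fst show ?thesis by (rule prod_eqI)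
qed

lemma classifying_hom_exists:
  assumes \<sigma>: "is_stratum \<S> \<sigma>" and \<tau>: "classifying B N \<tau> g g'"
    and f: "f \<in> cmap (boundary \<sigma>) (boundary \<tau>)" and w: "w \<in> cmap (body \<S> \<sigma>) B"
    and wf: "\<And>x. x \<in> topspace (boundary \<sigma>) \<Longrightarrow> w (body_incl \<S> \<sigma> x) = g (f x)"
    and N: "\<And>s. s \<in> cells \<sigma> \<Longrightarrow> N (cell_dim \<sigma> s) (compose (topspace (disc_boundary (cell_dim \<sigma> s))) f (attach \<sigma> s))"
  shows "\<exists>\<phi>\<in>stratum_hom \<sigma> \<tau>. fst \<phi> = f \<and> (\<forall>z\<in>topspace (body \<S> \<sigma>). g' (body_map \<S> \<sigma> \<tau> \<phi> z) = w z)"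
proof -
  have \<tau>': "is_stratum \<S> \<tau>" and g': "g' \<in> cmap (body \<S> \<tau>) B"
      "\<And>x. x \<in> topspace (boundary \<tau>) \<Longrightarrow> g' (body_incl \<S> \<tau> x) = g x"
    and bij: "bij_betw (cell_square \<tau> g') (cells \<tau>) (squares (boundary \<tau>) B g N)"
    using \<tau> by (auto simp: classifying_def)
  define sq where "sq s = (cell_dim \<sigma> s, compose (topspace (disc_boundary (cell_dim \<sigma> s))) f (attach \<sigma> s),
     \<lambda>x\<in>topspace (disc (cell_dim \<sigma> s)). w (body_char \<S> \<sigma> (s, x)))" for s
  have "sq s \<in> squares (boundary \<tau>) B g N" if s: "s \<in> cells \<sigma>" for s
  proof -
    have "continuous_map (disc (cell_dim \<sigma> s)) B (\<lambda>x. w (body_char \<S> \<sigma> (s, x)))"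
      using continuous_map_compose[OF body_char_continuous[OF \<sigma> s] cmap_imp_continuous_map[OF w]]
      by (simp add: comp_def)
    moreover have "g (f (attach \<sigma> s x)) = w (body_char \<S> \<sigma> (s, x))"
      if "x \<in> topspace (disc_boundary (cell_dim \<sigma> s))" for x
      using wf[OF attach_in[OF \<sigma> s that]] body_glue[OF \<sigma> s that] by simp
    ultimately show ?thesis
      using s disc_boundary_subset N compose_in_cmap[OF stratum_attach[OF \<sigma> s] f]
      by (auto simp: squares_def sq_def restrict_in_cmap_iff compose_eq)
  qed
  then have "\<forall>s\<in>cells \<sigma>. \<exists>t\<in>cells \<tau>. cell_square \<tau> g' t = sq s"
    using bij unfolding bij_betw_def by (metis imageE)
  then obtain p' where p': "\<And>s. s \<in> cells \<sigma> \<Longrightarrow> p' s \<in> cells \<tau>" "\<And>s. s \<in> cells \<sigma> \<Longrightarrow> cell_square \<tau> g' (p' s) = sq s"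
    by metis
  define p where "p = restrict p' (cells \<sigma>)"
  have p: "p s \<in> cells \<tau>" "cell_dim \<tau> (p s) = cell_dim \<sigma> s"
      "attach \<tau> (p s) = compose (topspace (disc_boundary (cell_dim \<sigma> s))) f (attach \<sigma> s)"
      "(\<lambda>x\<in>topspace (disc (cell_dim \<sigma> s)). g' (body_char \<S> \<tau> (p s, x))) =
        (\<lambda>x\<in>topspace (disc (cell_dim \<sigma> s)). w (body_char \<S> \<sigma> (s, x)))"
    if "s \<in> cells \<sigma>" for s
    using p'[OF that] that by (auto simp: p_def cell_square_def sq_def)
  have hom: "(f, p) \<in> stratum_hom \<sigma> \<tau>"
    using f p by (auto simp: stratum_hom_def p_def)
  define h where "h = compose (topspace (body \<S> \<sigma>)) g' (body_map \<S> \<sigma> \<tau> (f, p))"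
  have "h = w"
  proof (rule body_eqI[OF \<sigma> _ w])
    show "h \<in> cmap (body \<S> \<sigma>) B"
      unfolding h_def by (rule compose_in_cmap[OF body_map_in[OF \<sigma> \<tau>' hom] g'(1)])
    fix x assume "x \<in> topspace (boundary \<sigma>)"
    then show "h (body_incl \<S> \<sigma> x) = w (body_incl \<S> \<sigma> x)"
      using cmap_in[OF body_incl[OF \<sigma>]] cmap_in[OF f] g'(2) wf
      by (simp add: h_def compose_eq body_map_incl[OF \<sigma> \<tau>' hom])
  next
    fix s x assume *: "s \<in> cells \<sigma>" "x \<in> topspace (disc (cell_dim \<sigma> s))"
    then have "body_char \<S> \<sigma> (s, x) \<in> topspace (body \<S> \<sigma>)"
      using cmap_in[OF body_char[OF \<sigma>]] by (simp add: topspace_cell_discs)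
    then show "h (body_char \<S> \<sigma> (s, x)) = w (body_char \<S> \<sigma> (s, x))"
      using fun_cong[OF p(4)[OF *(1)], of x] * by (simp add: h_def compose_eq body_map_char[OF \<sigma> \<tau>' hom])
  qed
  then have "g' (body_map \<S> \<sigma> \<tau> (f, p) z) = w z" if "z \<in> topspace (body \<S> \<sigma>)" for z
    using that by (auto simp: h_def compose_eq)
  with hom show ?thesis by (intro bexI[of _ "(f, p)"]) auto
qed


section \<open>The classifying complex of a map\<close>

definition factors :: "'u stratum \<Rightarrow> nat \<Rightarrow> ((nat \<Rightarrow> real) \<Rightarrow> 'u) \<Rightarrow> bool" where
  "factors \<sigma> d b \<longleftrightarrow> (\<exists>c\<in>cmap (disc_boundary d) (boundary \<sigma>).
     b = compose (topspace (disc_boundary d)) (body_incl \<S> \<sigma>) c)"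

text \<open>Properness forbids factorisation through any earlier stage, but it suffices to exclude the
  previous one: the map from an earlier stage passes through it.\<close>

definition fresh :: "(nat \<Rightarrow> 'u stratum) \<Rightarrow> nat \<Rightarrow> nat \<Rightarrow> ((nat \<Rightarrow> real) \<Rightarrow> 'u) \<Rightarrow> bool" where
  "fresh K n d b \<longleftrightarrow> (\<forall>m. n = Suc m \<longrightarrow> \<not> factors (K m) d b)"

lemma proper_strata_iff_fresh:
  assumes K: "\<And>n. is_stratum \<S> (K n)" and conn: "connected_strata \<S> K"
  shows "proper_strata \<S> K \<longleftrightarrow> (\<forall>n. \<forall>s\<in>cells (K n). fresh K n (cell_dim (K n) s) (attach (K n) s))"
proof -
  have iter: "iter_incl \<S> K m k \<in> cmap (boundary (K m)) (boundary (K (m + k)))" for m k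
  proof (induction k)
    case (Suc k)
    then show ?case
      using body_incl[OF K, of "m + k"] conn
      by (auto simp: connected_strata_def intro: compose_in_cmap)
  qed (simp only: iter_incl.simps add_0_right id_in_cmap)
  show ?thesis
  proof
    assume proper: "proper_strata \<S> K"
    show "\<forall>n. \<forall>s\<in>cells (K n). fresh K n (cell_dim (K n) s) (attach (K n) s)"
      unfolding fresh_def
    proof (intro allI ballI impI notI)
      fix n s m assume s: "s \<in> cells (K n)" and n: "n = Suc m"
        and "factors (K m) (cell_dim (K n) s) (attach (K n) s)"
      then obtain c where c: "c \<in> cmap (disc_boundary (cell_dim (K n) s)) (boundary (K m))"
        "attach (K n) s = compose (topspace (disc_boundary (cell_dim (K n) s))) (body_incl \<S> (K m)) c"
        unfolding factors_def by blast
      have "attach (K n) s = compose (topspace (disc_boundary (cell_dim (K n) s))) (iter_incl \<S> K m (n - m)) c"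
        unfolding c(2) compose_eq_iff using cmap_in[OF c(1)] by (simp add: n compose_eq)
      with proper s c(1) n show False
        unfolding proper_strata_def by blast
    qed
  next
    assume fresh: "\<forall>n. \<forall>s\<in>cells (K n). fresh K n (cell_dim (K n) s) (attach (K n) s)"
    show "proper_strata \<S> K"
      unfolding proper_strata_def
    proof (intro notI, elim exE bexE conjE)
      fix n s m c
      let ?D = "disc_boundary (cell_dim (K n) s)"
      assume s: "s \<in> cells (K n)" and mn: "m < n" and c: "c \<in> cmap ?D (boundary (K m))"
        and eq: "attach (K n) s = compose (topspace ?D) (iter_incl \<S> K m (n - m)) c"
      define k where "k = n - Suc m"
      have n: "n = Suc (m + k)" "n - m = Suc k" using mn by (auto simp: k_def)
      have "attach (K n) s = compose (topspace ?D) (body_incl \<S> (K (m + k))) (compose (topspace ?D) (iter_incl \<S> K m k) c)"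
        unfolding eq n(2) iter_incl.simps by (rule cmap_compose_assoc[OF c, symmetric])
      moreover have "compose (topspace ?D) (iter_incl \<S> K m k) c \<in> cmap ?D (boundary (K (m + k)))"
        by (rule compose_in_cmap[OF c iter])
      ultimately have "factors (K (m + k)) (cell_dim (K n) s) (attach (K n) s)"
        unfolding factors_def by blast
      with fresh s n(1) show False unfolding fresh_def by blast
    qed
  qed
qed

definition classifying_complex ::
  "'u topology \<Rightarrow> (nat \<Rightarrow> 'u stratum) \<Rightarrow> (nat \<Rightarrow> 'u \<Rightarrow> 'u) \<Rightarrow> bool" where
  "classifying_complex B L G \<longleftrightarrow> is_cell_complex \<S> L \<and> (\<forall>n. G n \<in> cmap (boundary (L n)) B) \<and>
     (\<forall>n. classifying B (fresh L n) (L n) (G n) (G (Suc n)))"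

text \<open>Starting from \<open>f\<close>, repeatedly attach a cell for each square whose upper map does not factor
  through the previous stage. The boundary of the next stratum has to be the chosen body of the
  previous one, so the strata are found by dependent choice, each together with the map from its
  body to \<open>B\<close>.\<close>

lemma classifying_complex_exists:
  assumes A: "is_space \<S> A" and B: "is_space \<S> B" and f: "f \<in> cmap A B"
  shows "\<exists>L G. classifying_complex B L G \<and> boundary (L 0) = A \<and> G 0 = f"
proof -
  \<comment> \<open>\<open>P\<close> has to remember that the current map to \<open>B\<close> is continuous, which is part of being
    classifying for some \<open>N\<close> and \<open>g\<close>; only the first stage fixes them.\<close>
  define P where "P n F \<longleftrightarrow> (\<exists>N g. classifying B N (fst F) g (snd F)) \<and>
    (n = 0 \<longrightarrow> boundary (fst F) = A \<and> classifying B (\<lambda>_ _. True) (fst F) f (snd F))"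
    for n :: nat and F :: "'u stratum \<times> ('u \<Rightarrow> 'u)"
  define Q where "Q F F' \<longleftrightarrow> boundary (fst F') = body \<S> (fst F) \<and>
    classifying B (\<lambda>d b. \<not> factors (fst F) d b) (fst F') (snd F) (snd F')" for F F'
  have "\<exists>F. \<forall>n. P n (F n) \<and> Q (F n) (F (Suc n))"
  proof (rule dependent_nat_choice)
    obtain \<sigma> g' where "boundary \<sigma> = A" "classifying B (\<lambda>_ _. True) \<sigma> f g'"
      using classifying_stratum_exists[OF A B f, of "\<lambda>_ _. True"] by blast
    then show "\<exists>F. P 0 F"
      unfolding P_def by (intro exI[of _ "(\<sigma>, g')"]) auto
  next
    fix F n assume "P n F"
    then have "is_stratum \<S> (fst F)" "snd F \<in> cmap (body \<S> (fst F)) B"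
      unfolding P_def classifying_def by auto
    then obtain \<sigma> g' where "boundary \<sigma> = body \<S> (fst F)"
      "classifying B (\<lambda>d b. \<not> factors (fst F) d b) \<sigma> (snd F) g'"
      using classifying_stratum_exists[OF body_space B] by blast
    then show "\<exists>F'. P (Suc n) F' \<and> Q F F'"
      unfolding P_def Q_def by (intro exI[of _ "(\<sigma>, g')"]) auto
  qed
  then obtain F where F: "\<And>n. P n (F n)" "\<And>n. Q (F n) (F (Suc n))" by blast
  define L where "L n = fst (F n)" for n
  define G where "G n = (case n of 0 \<Rightarrow> f | Suc m \<Rightarrow> snd (F m))" for n
  have "fresh L 0 = (\<lambda>_ _. True)" "fresh L (Suc n) = (\<lambda>d b. \<not> factors (L n) d b)" for n
    by (simp_all add: fresh_def fun_eq_iff)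
  then have cl: "classifying B (fresh L n) (L n) (G n) (G (Suc n))" for n
    using F(1)[of 0] F(2) by (cases n) (auto simp: P_def Q_def L_def G_def)
  have bd: "boundary (L 0) = A" "boundary (L (Suc n)) = body \<S> (L n)" for n
    using F(1)[of 0] F(2)[of n] by (simp_all add: P_def Q_def L_def)
  have L: "is_stratum \<S> (L n)" and bij: "bij_betw (cell_square (L n) (G (Suc n))) (cells (L n)) (squares (boundary (L n)) B (G n) (fresh L n))"
    and GSuc: "G (Suc n) \<in> cmap (boundary (L (Suc n))) B" for n
    using cl[of n] by (simp_all add: classifying_def bd)
  have G: "G n \<in> cmap (boundary (L n)) B" for n
    using GSuc f by (cases n) (simp_all add: G_def bd)
  have conn: "connected_strata \<S> L"
    by (simp add: connected_strata_def bd)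
  have "proper_strata \<S> L"
    unfolding proper_strata_iff_fresh[OF L conn]
  proof (intro allI ballI)
    fix n s assume "s \<in> cells (L n)"
    then have "cell_square (L n) (G (Suc n)) s \<in> squares (boundary (L n)) B (G n) (fresh L n)"
      using bij_betwE[OF bij] by blast
    then show "fresh L n (cell_dim (L n) s) (attach (L n) s)"
      by (simp add: cell_square_def squares_def)
  qed
  then have "classifying_complex B L G"
    unfolding classifying_complex_def is_cell_complex_def using L conn G cl by blast
  moreover have "G 0 = f" by (simp add: G_def)
  ultimately show ?thesis using bd(1) by blast
qed

text \<open>The maps \<open>w n\<close> form a cocone from the stages of \<open>K\<close> to \<open>B\<close>. At each stage the map on
  boundaries is given (by \<open>u\<close>, or as the map of bodies induced by the stage before), and the map
  on cells is the only one that is compatible with \<open>w\<close>. A cell of \<open>K\<close> has a fresh attaching map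
  since \<open>K\<close> is proper, and its image under the map on boundaries is again fresh by
  \<open>factors_if_body_map_factors\<close>; so there is a cell of \<open>L\<close> to which it can be sent.\<close>

lemma classifying_complex_universal:
  assumes L: "classifying_complex B L G" and K: "is_cell_complex \<S> K"
    and u: "u \<in> cmap (boundary (K 0)) (boundary (L 0))"
    and w: "\<And>n. w n \<in> cmap (boundary (K n)) B"
    and w_Suc: "\<And>n x. x \<in> topspace (boundary (K n)) \<Longrightarrow> w (Suc n) (body_incl \<S> (K n) x) = w n x"
    and w_0: "\<And>x. x \<in> topspace (boundary (K 0)) \<Longrightarrow> w 0 x = G 0 (u x)"
  shows "\<exists>!\<phi>. \<phi> \<in> cell_complex_hom \<S> K L \<and> fst (\<phi> 0) = u \<and>
    (\<forall>n. \<forall>x\<in>topspace (boundary (K n)). G n (fst (\<phi> n) x) = w n x)"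
proof (rule ex_ex1I)
  have L': "is_cell_complex \<S> L" and cl: "\<And>n. classifying B (fresh L n) (L n) (G n) (G (Suc n))"
    using L by (auto simp: classifying_complex_def)
  note strK = cell_complex_stratum[OF K] and strL = cell_complex_stratum[OF L']
  note bdK = cell_complex_boundary_Suc[OF K] and bdL = cell_complex_boundary_Suc[OF L']
  have fresh: "fresh K n (cell_dim (K n) s) (attach (K n) s)" if "s \<in> cells (K n)" for n s
    using K that proper_strata_iff_fresh[of K] unfolding is_cell_complex_def by blast
  have w': "w (Suc n) \<in> cmap (body \<S> (K n)) B" for n
    using w[of "Suc n"] by (simp add: bdK)
  define P where "P n \<phi> \<longleftrightarrow> \<phi> \<in> stratum_hom (K n) (L n) \<and> (n = 0 \<longrightarrow> fst \<phi> = u) \<and>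
      (\<forall>z\<in>topspace (body \<S> (K n)). G (Suc n) (body_map \<S> (K n) (L n) \<phi> z) = w (Suc n) z)" for n \<phi>
  have "\<exists>\<phi>. \<forall>n. P n (\<phi> n) \<and> fst (\<phi> (Suc n)) = body_map \<S> (K n) (L n) (\<phi> n)"
  proof (rule dependent_nat_choice)
    have "\<exists>\<phi>\<in>stratum_hom (K 0) (L 0). fst \<phi> = u \<and>
        (\<forall>z\<in>topspace (body \<S> (K 0)). G (Suc 0) (body_map \<S> (K 0) (L 0) \<phi> z) = w (Suc 0) z)"
      by (rule classifying_hom_exists[OF strK cl u w']) (simp_all add: w_Suc w_0 fresh_def)
    then show "\<exists>\<phi>. P 0 \<phi>" unfolding P_def by blast
  next
    fix \<phi> n assume "P n \<phi>"
    then have \<phi>: "\<phi> \<in> stratum_hom (K n) (L n)"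
      and G\<phi>: "\<And>z. z \<in> topspace (body \<S> (K n)) \<Longrightarrow> G (Suc n) (body_map \<S> (K n) (L n) \<phi> z) = w (Suc n) z"
      unfolding P_def by auto
    let ?f = "body_map \<S> (K n) (L n) \<phi>"
    have f: "?f \<in> cmap (boundary (K (Suc n))) (boundary (L (Suc n)))"
      unfolding bdK bdL by (rule body_map_in[OF strK strL \<phi>])
    have "\<exists>\<phi>'\<in>stratum_hom (K (Suc n)) (L (Suc n)). fst \<phi>' = ?f \<and>
        (\<forall>z\<in>topspace (body \<S> (K (Suc n))).
          G (Suc (Suc n)) (body_map \<S> (K (Suc n)) (L (Suc n)) \<phi>' z) = w (Suc (Suc n)) z)"
    proof (rule classifying_hom_exists[OF strK cl f w'])
      show "w (Suc (Suc n)) (body_incl \<S> (K (Suc n)) x) = G (Suc n) (?f x)"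
        if "x \<in> topspace (boundary (K (Suc n)))" for x
        using that w_Suc G\<phi> by (simp add: bdK)
      fix s assume s: "s \<in> cells (K (Suc n))"
      let ?D = "disc_boundary (cell_dim (K (Suc n)) s)"
      have att: "attach (K (Suc n)) s \<in> cmap ?D (body \<S> (K n))"
        using stratum_attach[OF strK s] by (simp add: bdK)
      have "factors (K n) (cell_dim (K (Suc n)) s) (attach (K (Suc n)) s)"
        if "factors (L n) (cell_dim (K (Suc n)) s) (compose (topspace ?D) ?f (attach (K (Suc n)) s))"
      proof -
        from that obtain c where c: "c \<in> cmap ?D (boundary (L n))"
          "compose (topspace ?D) ?f (attach (K (Suc n)) s) = compose (topspace ?D) (body_incl \<S> (L n)) c"
          unfolding factors_def by blast
        show ?thesis
          unfolding factors_def
          by (rule factors_if_body_map_factors[OF strK strL \<phi> att c(1)])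
            (use c(2) in \<open>simp add: compose_eq_iff\<close>)
      qed
      then show "fresh L (Suc n) (cell_dim (K (Suc n)) s) (compose (topspace ?D) ?f (attach (K (Suc n)) s))"
        using fresh[OF s] by (auto simp: fresh_def)
    qed
    then show "\<exists>\<phi>'. P (Suc n) \<phi>' \<and> fst \<phi>' = ?f"
      unfolding P_def by auto
  qed
  then obtain \<phi> where \<phi>: "\<And>n. P n (\<phi> n)" "\<And>n. fst (\<phi> (Suc n)) = body_map \<S> (K n) (L n) (\<phi> n)"
    by blast
  have "G n (fst (\<phi> n) x) = w n x" if "x \<in> topspace (boundary (K n))" for n x
    using that \<phi>(1)[of 0] \<phi>(1)[of "n - 1"] w_0 by (cases n) (auto simp: P_def \<phi>(2) bdK)
  then show "\<exists>\<phi>. \<phi> \<in> cell_complex_hom \<S> K L \<and> fst (\<phi> 0) = u \<and>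
    (\<forall>n. \<forall>x\<in>topspace (boundary (K n)). G n (fst (\<phi> n) x) = w n x)"
    using \<phi> by (intro exI[of _ \<phi>]) (auto simp: P_def cell_complex_hom_def)
next
  have L': "is_cell_complex \<S> L" and cl: "\<And>n. classifying B (fresh L n) (L n) (G n) (G (Suc n))"
    using L by (auto simp: classifying_complex_def)
  note bdK = cell_complex_boundary_Suc[OF K]
  fix \<phi> \<psi>
  assume "\<phi> \<in> cell_complex_hom \<S> K L \<and> fst (\<phi> 0) = u \<and>
      (\<forall>n. \<forall>x\<in>topspace (boundary (K n)). G n (fst (\<phi> n) x) = w n x)"
    and "\<psi> \<in> cell_complex_hom \<S> K L \<and> fst (\<psi> 0) = u \<and>
      (\<forall>n. \<forall>x\<in>topspace (boundary (K n)). G n (fst (\<psi> n) x) = w n x)"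
  then have \<phi>: "\<phi> \<in> cell_complex_hom \<S> K L" "fst (\<phi> 0) = u"
      "\<And>n x. x \<in> topspace (boundary (K n)) \<Longrightarrow> G n (fst (\<phi> n) x) = w n x"
    and \<psi>: "\<psi> \<in> cell_complex_hom \<S> K L" "fst (\<psi> 0) = u"
      "\<And>n x. x \<in> topspace (boundary (K n)) \<Longrightarrow> G n (fst (\<psi> n) x) = w n x"
    by blast+
  have step: "\<phi> n = \<psi> n" if "fst (\<phi> n) = fst (\<psi> n)" for n
  proof (rule classifying_hom_unique[OF cell_complex_stratum[OF K] cl cell_complex_hom_stratum[OF \<phi>(1)]
        cell_complex_hom_stratum[OF \<psi>(1)] that])
    fix z assume "z \<in> topspace (body \<S> (K n))"
    then show "G (Suc n) (body_map \<S> (K n) (L n) (\<phi> n) z) = w (Suc n) z"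
      "G (Suc n) (body_map \<S> (K n) (L n) (\<psi> n) z) = w (Suc n) z"
      using \<phi>(3)[of z "Suc n"] \<psi>(3)[of z "Suc n"]
      by (simp_all add: bdK cell_complex_hom_Suc[OF \<phi>(1)] cell_complex_hom_Suc[OF \<psi>(1)])
  qed
  have "\<phi> n = \<psi> n" for n
  proof (induction n)
    case 0
    show ?case by (rule step) (simp add: \<phi>(2) \<psi>(2))
  next
    case (Suc n)
    then show ?case
      by (intro step) (simp add: cell_complex_hom_Suc[OF \<phi>(1)] cell_complex_hom_Suc[OF \<psi>(1)])
  qed
  then show "\<phi> = \<psi>" by (rule ext)
qed

text \<open>The value of the right adjoint at \<open>f\<close> is the classifying complex of \<open>f\<close>, and the counit is
  the identity on boundaries and the colimit of the maps \<open>G n\<close> on bodies. By the universal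
  property of the body of \<open>K\<close>, compatibility with the counit can be checked stage by stage.\<close>

lemma universal_arrow_exists:
  assumes Y: "Y \<in> Obj (arrow_category (Top \<S>))"
  shows "\<exists>R\<in>Obj (CellCx \<S>). \<exists>e\<in>Hom (arrow_category (Top \<S>)) (ObjMap (U_CellCx \<S>) R) Y.
    \<forall>X\<in>Obj (CellCx \<S>). \<forall>g\<in>Hom (arrow_category (Top \<S>)) (ObjMap (U_CellCx \<S>) X) Y.
      \<exists>!h. h \<in> Hom (CellCx \<S>) X R \<and>
        Comp (arrow_category (Top \<S>)) (ObjMap (U_CellCx \<S>) X) (ObjMap (U_CellCx \<S>) R) Y e
          (ArrMap (U_CellCx \<S>) X R h) = g"
proof -
  obtain A B f where Y_eq: "Y = (A, B, f)" by (cases Y)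
  with Y have A: "is_space \<S> A" and B: "is_space \<S> B" and f: "f \<in> cmap A B"
    by (auto simp: arrow_category_def Top_def)
  obtain L G where L: "classifying_complex B L G" and L0: "boundary (L 0) = A" and G0: "G 0 = f"
    using classifying_complex_exists[OF A B f] by blast
  have L': "is_cell_complex \<S> L" and G: "\<And>n. G n \<in> cmap (boundary (L n)) B"
    and G_Suc: "\<And>n x. x \<in> topspace (boundary (L n)) \<Longrightarrow> G (Suc n) (body_incl \<S> (L n) x) = G n x"
    using L by (auto simp: classifying_complex_def classifying_def)
  obtain e where e: "e \<in> cmap (complex_body \<S> L) B"
    and eG: "\<And>n x. x \<in> topspace (boundary (L n)) \<Longrightarrow> e (complex_incl \<S> L n x) = G n x"
    using complex_body_universal[OF L' B G G_Suc] by blast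
  let ?id = "restrict id (topspace A)"
  have "(?id, e) \<in> Hom (arrow_category (Top \<S>)) (ObjMap (U_CellCx \<S>) L) Y"
    using e eG[of _ 0] id_in_cmap[of A]
    by (simp add: arrow_category_def Top_def U_CellCx_def Y_eq L0 G0 compose_eq_iff)
  moreover have "\<exists>!\<phi>. \<phi> \<in> Hom (CellCx \<S>) K L \<and>
      Comp (arrow_category (Top \<S>)) (ObjMap (U_CellCx \<S>) K) (ObjMap (U_CellCx \<S>) L) Y (?id, e)
        (ArrMap (U_CellCx \<S>) K L \<phi>) = g"
    if K': "K \<in> Obj (CellCx \<S>)" and g: "g \<in> Hom (arrow_category (Top \<S>)) (ObjMap (U_CellCx \<S>) K) Y" for K g
  proof -
    have K: "is_cell_complex \<S> K" using K' by (simp add: CellCx_simps)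
    obtain u v where g_eq: "g = (u, v)" by (cases g)
    with g have u: "u \<in> cmap (boundary (K 0)) A" and v: "v \<in> cmap (complex_body \<S> K) B"
      and uv: "\<And>x. x \<in> topspace (boundary (K 0)) \<Longrightarrow> f (u x) = v (complex_incl \<S> K 0 x)"
      by (auto simp: arrow_category_def Top_def U_CellCx_def Y_eq compose_eq_iff)
    define w where "w n = compose (topspace (boundary (K n))) v (complex_incl \<S> K n)" for n
    have "\<exists>!\<phi>. \<phi> \<in> cell_complex_hom \<S> K L \<and> fst (\<phi> 0) = u \<and>
      (\<forall>n. \<forall>x\<in>topspace (boundary (K n)). G n (fst (\<phi> n) x) = w n x)"
    proof (rule classifying_complex_universal[OF L K])
      show "u \<in> cmap (boundary (K 0)) (boundary (L 0))" using u by (simp add: L0)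
      show "w n \<in> cmap (boundary (K n)) B" for n
        unfolding w_def by (rule compose_in_cmap[OF complex_incl[OF K] v])
      show "w (Suc n) (body_incl \<S> (K n) x) = w n x" if "x \<in> topspace (boundary (K n))" for n x
        using that cmap_in[OF body_incl_step[OF K] that] by (simp add: w_def compose_eq complex_incl_Suc[OF K])
      show "w 0 x = G 0 (u x)" if "x \<in> topspace (boundary (K 0))" for x
        using that uv by (simp add: w_def compose_eq G0)
    qed
    moreover have "Comp (arrow_category (Top \<S>)) (ObjMap (U_CellCx \<S>) K) (ObjMap (U_CellCx \<S>) L) Y (?id, e)
          (ArrMap (U_CellCx \<S>) K L \<phi>) = g \<longleftrightarrow>
        fst (\<phi> 0) = u \<and> (\<forall>n. \<forall>x\<in>topspace (boundary (K n)). G n (fst (\<phi> n) x) = w n x)"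
      if \<phi>: "\<phi> \<in> cell_complex_hom \<S> K L" for \<phi>
    proof -
      let ?b = "complex_body_map \<S> K L \<phi>"
      have b: "?b \<in> cmap (complex_body \<S> K) (complex_body \<S> L)"
        by (rule complex_body_map_in[OF K L' \<phi>])
      have eb: "compose (topspace (complex_body \<S> K)) e ?b \<in> cmap (complex_body \<S> K) B"
        by (rule compose_in_cmap[OF b e])
      have eb_incl: "compose (topspace (complex_body \<S> K)) e ?b (complex_incl \<S> K n x) = G n (fst (\<phi> n) x)"
        if "x \<in> topspace (boundary (K n))" for n x
        using that cmap_in[OF complex_incl[OF K] that] cmap_in[OF cell_complex_hom_fst[OF \<phi>] that]
        by (simp add: compose_eq complex_body_map_incl[OF K L' \<phi>] eG)
      have "compose (topspace (complex_body \<S> K)) e ?b = v \<longleftrightarrow>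
          (\<forall>n. \<forall>x\<in>topspace (boundary (K n)). G n (fst (\<phi> n) x) = w n x)"
      proof
        assume "compose (topspace (complex_body \<S> K)) e ?b = v"
        then show "\<forall>n. \<forall>x\<in>topspace (boundary (K n)). G n (fst (\<phi> n) x) = w n x"
          using eb_incl by (simp add: w_def compose_eq)
      next
        assume "\<forall>n. \<forall>x\<in>topspace (boundary (K n)). G n (fst (\<phi> n) x) = w n x"
        then show "compose (topspace (complex_body \<S> K)) e ?b = v"
          by (intro complex_body_eqI[OF K B eb v]) (simp add: eb_incl w_def compose_eq)
      qed
      moreover have "compose (topspace (boundary (K 0))) ?id (fst (\<phi> 0)) = fst (\<phi> 0)"
        using cell_complex_hom_fst[OF \<phi>, of 0] by (simp add: L0 cmap_compose_id_left)
      ultimately show ?thesis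
        by (simp add: arrow_category_def Top_def U_CellCx_def Y_eq g_eq)
    qed
    ultimately show ?thesis
      by (simp add: CellCx_simps cong: conj_cong)
  qed
  ultimately show ?thesis
    using L' by (intro bexI[of _ L] bexI[of _ "(?id, e)"]) (auto simp: CellCx_simps)
qed

end

theorem proposition5p2:
  fixes \<S> :: "'u set set"
  assumes "universe \<S>"
  shows "has_right_adjoint (CellCx \<S>) (arrow_category (Top \<S>)) (U_CellCx \<S>)"
proof -
  interpret small_universe \<S> by unfold_locales (rule assms)
  show ?thesis
    by (rule has_right_adjoint_if_universal_arrows[OF is_functor_U_CellCx universal_arrow_exists])
qed

end
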